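(* Let $\mu>0$ be an arbitrarily small constant. For $n$-vertex graphs $G$ with diversity $D$ and maximum clique size $S$, with $S$ sufficiently large, and for every integer $x$ with $1\le x\le o(\log S)$, there is a deterministic distributed algorithm in the LOCAL model that computes a proper vertex coloring of $G$ with $(1+\mu)\,S\cdot D^{x+1}$ colors within $\tilde O\big(x\cdot\sqrt{D\cdot S^{1/(x+1)}}\big)+O(\log^* n)$ rounds.
   Context: LOCAL model: the input graph is the communication network; each vertex is a processor with a unique ID of $O(\log n)$ bits and unbounded local computation; computation proceeds in synchronous rounds, in each of which every vertex may send a message of arbitrary size to each neighbor; running time is the number of rounds until all vertices terminate. Global parameters are assumed known to all vertices. The diversity of a vertex is the number of maximal cliques containing it; $D(G)$ is the maximum over all vertices. $\tilde O(f)$ hides factors polylogarithmic in the maximum degree of $G$. *)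

theory Defs
  imports Complex_Main "HOL-Library.Landau_Symbols"
begin

text \<open>Simple undirected graphs: vertices are natural numbers, which double as the
unique identifiers of the processors.\<close>

definition simple_graph :: "nat set \<Rightarrow> (nat \<Rightarrow> nat \<Rightarrow> bool) \<Rightarrow> bool" where
  "simple_graph V E \<longleftrightarrow> finite V \<and> (\<forall>u w. E u w \<longrightarrow> u \<in> V \<and> w \<in> V \<and> u \<noteq> w \<and> E w u)"

definition is_clique :: "nat set \<Rightarrow> (nat \<Rightarrow> nat \<Rightarrow> bool) \<Rightarrow> nat set \<Rightarrow> bool" where
  "is_clique V E K \<longleftrightarrow> K \<subseteq> V \<and> (\<forall>a\<in>K. \<forall>b\<in>K. a \<noteq> b \<longrightarrow> E a b)"

definition is_maximal_clique :: "nat set \<Rightarrow> (nat \<Rightarrow> nat \<Rightarrow> bool) \<Rightarrow> nat set \<Rightarrow> bool" where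
  "is_maximal_clique V E K \<longleftrightarrow> is_clique V E K \<and> (\<forall>K'. is_clique V E K' \<and> K \<subseteq> K' \<longrightarrow> K' = K)"

definition vertex_diversity :: "nat set \<Rightarrow> (nat \<Rightarrow> nat \<Rightarrow> bool) \<Rightarrow> nat \<Rightarrow> nat" where
  "vertex_diversity V E v = card {K. is_maximal_clique V E K \<and> v \<in> K}"

definition diversity :: "nat set \<Rightarrow> (nat \<Rightarrow> nat \<Rightarrow> bool) \<Rightarrow> nat" where
  "diversity V E = Max (vertex_diversity V E ` V)"

definition max_clique_size :: "nat set \<Rightarrow> (nat \<Rightarrow> nat \<Rightarrow> bool) \<Rightarrow> nat" where
  "max_clique_size V E = Max (card ` {K. is_clique V E K})"

definition max_degree :: "nat set \<Rightarrow> (nat \<Rightarrow> nat \<Rightarrow> bool) \<Rightarrow> nat" where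
  "max_degree V E = Max ((\<lambda>v. card {w. E v w}) ` V)"

definition proper_coloring :: "nat set \<Rightarrow> (nat \<Rightarrow> nat \<Rightarrow> bool) \<Rightarrow> (nat \<Rightarrow> nat) \<Rightarrow> bool" where
  "proper_coloring V E col \<longleftrightarrow> (\<forall>u\<in>V. \<forall>w\<in>V. E u w \<longrightarrow> col u \<noteq> col w)"

definition ball_of :: "nat set \<Rightarrow> (nat \<Rightarrow> nat \<Rightarrow> bool) \<Rightarrow> nat \<Rightarrow> nat \<Rightarrow> nat set" where
  "ball_of V E t v = {w \<in> V. \<exists>k\<le>t. (v, w) \<in> {(a, b). E a b} ^^ k}"

text \<open>Knowledge of vertex v after t synchronous rounds of the LOCAL model (arbitrary message
size): its own identifier, the identifiers of all vertices within distance t, and all edges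
with at least one endpoint at distance < t. A deterministic t-round LOCAL algorithm is
exactly a function of this view (together with the globally known parameters).\<close>
definition local_view :: "nat set \<Rightarrow> (nat \<Rightarrow> nat \<Rightarrow> bool) \<Rightarrow> nat \<Rightarrow> nat
    \<Rightarrow> nat \<times> nat set \<times> (nat \<Rightarrow> nat \<Rightarrow> bool)" where
  "local_view V E t v =
     (v, ball_of V E t v,
      \<lambda>a b. E a b \<and> a \<in> ball_of V E t v \<and> b \<in> ball_of V E t v \<and>
            0 < t \<and> (a \<in> ball_of V E (t - 1) v \<or> b \<in> ball_of V E (t - 1) v))"

definition log_star :: "real \<Rightarrow> nat" where
  "log_star y = (LEAST k. ((\<lambda>z. log 2 z) ^^ k) y \<le> 1)"

end

(*
A maximal clique meeting a colour class is cut, by rank of identifiers, into blocks of size t;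
the graph of all pairs sharing a block has degree at most D(t-1), and colouring it properly with
D t colours leaves at most a 1/t fraction (rounded up) of each clique monochromatic.  Doing this
x + 1 times with factors t_i of order S^(1/(x+1)) whose product is S + o(S) gives a proper
colouring with (1 + o(1)) S D^(x+1) colours.

Each level needs a (delta+1)-colouring in about sqrt(delta) rounds.  Everything there comes from one
greedy code: polynomially many functions [a] -> [2a], any two of which agree, even after a cyclic shift,
in only O(log) places.  Such a code gives Linial's colour reduction (for the initial colouring, in
log* n rounds).  It also gives a partition into O(a) classes with an orientation of small out-degree: at
time t an undecided vertex tries the value of its function at t and keeps it if few neighbours hold the
same value.  Finally, with the palette arranged as an [a] x [2a] grid, it lets all vertices of
one class choose a free colour at the same time: a vertex picks the shift of its function whose graph
contains most free colours, and then a point of that graph avoiding the graphs of its out-neighbours.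
Treating only vertices whose uncoloured degree is within a factor two of the maximum, and halving this
maximum, needs only logarithmically many passes.
*)
theory Submission
  imports Defs "HOL-Library.FuncSet" "HOL-Library.Log_Nat" "HOL-Real_Asymp.Real_Asymp"
begin

text \<open>The square root comes from the grid: it needs 2 * a * a \<ge> \<delta> + 1 points, so a
  is about sqrt(\<delta> + 1), while tries and classes number O(a) up to squared logarithms. A
  vertex with at least \<theta> / 2 uncoloured neighbours has more than \<theta> / 2 free colours,
  because the palette exceeds the degree. The best of its 2 * a shifted graphs contains more than
  \<theta> / (4 * a) of them, and each out-neighbour spoils at most d. So an out-degree of order
  \<theta> / (4 * a * d) is affordable. A vertex with fewer uncoloured neighbours may have too few
  free colours and has to wait for a smaller \<theta>. The levels control clique size minus one,
  which each level divides by its factor without rounding loss. Once the product of the factors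
  reaches S the quantity is below 1, so classes are independent and no final pass is needed. All
  levels reuse one initial colouring, so log* n is paid once. The slack 1 + \<mu> pays only for
  rounding the factors to integers: x = o(log S) makes S^(1/(x+1)) exceed 1 / \<mu>, and the excess
  of the product over S is at most S / S^(1/(x+1)).\<close>

section \<open>Locality\<close>

text \<open>\<open>agree r E E' v\<close> says that after \<open>r\<close> rounds \<open>v\<close> cannot tell \<open>E\<close> from \<open>E'\<close>, so \<open>loc r F\<close> says
  that the labelling \<open>F\<close> of graphs can be computed in \<open>r\<close> rounds. The vertex set is left out; a label is
  assigned to every natural number.\<close>

primrec agree :: "nat \<Rightarrow> (nat \<Rightarrow> nat \<Rightarrow> bool) \<Rightarrow> (nat \<Rightarrow> nat \<Rightarrow> bool) \<Rightarrow> nat \<Rightarrow> bool" where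
  "agree 0 E E' v = True"
| "agree (Suc r) E E' v \<longleftrightarrow> E v = E' v \<and> agree r E E' v \<and> (\<forall>w. E v w \<longrightarrow> agree r E E' w)"

definition loc :: "nat \<Rightarrow> ((nat \<Rightarrow> nat \<Rightarrow> bool) \<Rightarrow> nat \<Rightarrow> 'a) \<Rightarrow> bool" where
  "loc r F \<longleftrightarrow> (\<forall>E E' v. agree r E E' v \<longrightarrow> F E v = F E' v)"

lemma agree_mono: "agree s E E' v \<Longrightarrow> r \<le> s \<Longrightarrow> agree r E E' v"
proof (induction s arbitrary: r v)
  case (Suc s)
  then show ?case by (cases r) auto
qed simp

lemma locI: "(\<And>E E' v. agree r E E' v \<Longrightarrow> F E v = F E' v) \<Longrightarrow> loc r F"
  by (simp add: loc_def)

lemma locD: "loc r F \<Longrightarrow> agree s E E' v \<Longrightarrow> r \<le> s \<Longrightarrow> F E v = F E' v"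
  using agree_mono unfolding loc_def by blast

text \<open>The only place where a round is paid for: reading a neighbour's label needs one round
  more than computing it.\<close>

lemma locD_nbr:
  assumes "loc r F" "agree s E E' v" "r < s" "E v w"
  shows "F E w = F E' w"
proof -
  obtain s' where "s = Suc s'" using assms(3) by (cases s) auto
  with assms show ?thesis by (auto intro: locD[of r F s'])
qed

lemma loc_mono: "loc r F \<Longrightarrow> r \<le> s \<Longrightarrow> loc s F"
  using agree_mono unfolding loc_def by blast

lemma loc_comp: "loc r F \<Longrightarrow> loc r (\<lambda>E v. h (F E v))"
  by (simp add: loc_def)

lemma loc_comp2: "loc r F \<Longrightarrow> loc r G \<Longrightarrow> loc r (\<lambda>E v. h (F E v) (G E v))"
  by (simp add: loc_def)

section \<open>From the views of the theorem to \<open>agree\<close>\<close>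

lemma in_ball_ofI: "(v, w) \<in> {(a, b). E a b} ^^ k \<Longrightarrow> k \<le> t \<Longrightarrow> w \<in> V \<Longrightarrow> w \<in> ball_of V E t v"
  unfolding ball_of_def by blast

text \<open>Every edge of a walk of length at most t starts at a vertex at distance less than t, so
  it belongs to the view and exists in the other graph too.\<close>

lemma local_view_relpow:
  assumes "simple_graph V E" "v \<in> V"
    and view: "local_view V E t v = local_view V' E' t v"
    and "k \<le> t" "(v, w) \<in> {(a, b). E a b} ^^ k"
  shows "(v, w) \<in> {(a, b). E' a b} ^^ k"
  using assms(4,5)
proof (induction k arbitrary: w)
  case (Suc k)
  then obtain u where u: "(v, u) \<in> {(a, b). E a b} ^^ k" "E u w" by auto
  have "u \<in> V" "w \<in> V" using u assms(1) by (auto simp: simple_graph_def)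
  then have "u \<in> ball_of V E (t - 1) v" "u \<in> ball_of V E t v" "w \<in> ball_of V E t v"
    using in_ball_ofI[OF u(1)] in_ball_ofI[OF Suc.prems(2,1)] Suc.prems(1) by auto
  moreover have "(E u w \<and> u \<in> ball_of V E t v \<and> w \<in> ball_of V E t v \<and>
            0 < t \<and> (u \<in> ball_of V E (t - 1) v \<or> w \<in> ball_of V E (t - 1) v)) =
       (E' u w \<and> u \<in> ball_of V' E' t v \<and> w \<in> ball_of V' E' t v \<and>
            0 < t \<and> (u \<in> ball_of V' E' (t - 1) v \<or> w \<in> ball_of V' E' (t - 1) v))"
    using view unfolding local_view_def by (auto dest!: fun_cong)
  ultimately have "E' u w" using Suc.prems u(2) by auto
  then show ?case using Suc u by (auto intro: relcompI)
qed simp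

lemma relpow_in_V:
  assumes "simple_graph V E" "v \<in> V" "(v, w) \<in> {(a, b). E a b} ^^ k"
  shows "w \<in> V"
  using assms by (cases k) (auto simp: simple_graph_def)

text \<open>The induction step towards \<open>agree\<close>: a view of radius t + 1 contains the
  radius-t views of the vertex and of its neighbours. The case w = v is included because
  \<open>agree\<close> also recurses at the vertex itself.\<close>

lemma local_view_nbr:
  assumes g: "simple_graph V E" "simple_graph V' E'" and v: "v \<in> V" "v \<in> V'"
    and view: "local_view V E (Suc t) v = local_view V' E' (Suc t) v"
    and w: "w = v \<or> E v w"
  shows "local_view V E t w = local_view V' E' t w"
    and "w \<in> V" "w \<in> V'" "E v = E' v"
proof -
  \<comment> \<open>The larger view shows every edge with an endpoint within distance t of v, so
    whole rows of the adjacency relation agree there.\<close>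
  have edge: "E a b = E' a b" if "(v, a) \<in> {(a, b). E a b} ^^ k" "k \<le> t" for a b k
  proof -
    have a': "(v, a) \<in> {(a, b). E' a b} ^^ k"
      using local_view_relpow[OF g(1) v(1) view _ that(1)] that by simp
    have "(v, b) \<in> {(a, b). E' a b} ^^ Suc k" if "E a b"
      using local_view_relpow[OF g(1) v(1) view, of "Suc k" b] that \<open>(v, a) \<in> {(a, b). E a b} ^^ k\<close> \<open>k \<le> t\<close>
      by (auto intro: relcompI)
    have aV: "a \<in> V" "a \<in> V'"
      using relpow_in_V[OF g(1) v(1) that(1)] relpow_in_V[OF g(2) v(2) a'] .
    have *: "a \<in> ball_of V E t v" "a \<in> ball_of V' E' t v"
       "a \<in> ball_of V E (Suc t) v" "a \<in> ball_of V' E' (Suc t) v"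
      using aV a' that unfolding ball_of_def by (auto intro!: exI[of _ k])
    have b1: "E a b \<Longrightarrow> b \<in> ball_of V E (Suc t) v"
      using g(1) that unfolding ball_of_def simple_graph_def
      by (auto intro!: exI[of _ "Suc k"] intro: relcompI)
    have b2: "E' a b \<Longrightarrow> b \<in> ball_of V' E' (Suc t) v"
      using g(2) that a' unfolding ball_of_def simple_graph_def
      by (auto intro!: exI[of _ "Suc k"] intro: relcompI)
    have "(E a b \<and> a \<in> ball_of V E (Suc t) v \<and> b \<in> ball_of V E (Suc t) v \<and>
            (a \<in> ball_of V E t v \<or> b \<in> ball_of V E t v)) =
       (E' a b \<and> a \<in> ball_of V' E' (Suc t) v \<and> b \<in> ball_of V' E' (Suc t) v \<and>
            (a \<in> ball_of V' E' t v \<or> b \<in> ball_of V' E' t v))"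
      using view unfolding local_view_def by (auto dest!: fun_cong)
    then show ?thesis using * b1 b2 by blast
  qed
  show Ev: "E v = E' v" using edge[of v 0] by auto
  show wV: "w \<in> V" "w \<in> V'" using w v g Ev unfolding simple_graph_def by metis+
  \<comment> \<open>A walk of length k from w becomes one of length k + 1 from v, hence the strict
    bound on k.\<close>
  have edge': "E a b = E' a b" if "(w, a) \<in> {(a, b). E a b} ^^ k" "k < t" for a b k
  proof (cases "w = v")
    case True
    then show ?thesis using edge[of a k b] that by simp
  next
    case False
    then have "(v, a) \<in> {(a, b). E a b} ^^ Suc k"
      using w that by (metis (mono_tags, lifting) case_prodI mem_Collect_eq relpow_Suc_I2)
    then show ?thesis using edge[of a "Suc k" b] that by simp
  qed
  have path: "(w, a) \<in> {(a, b). E a b} ^^ k \<longleftrightarrow> (w, a) \<in> {(a, b). E' a b} ^^ k" if "k \<le> t" for a k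
    using that
  proof (induction k arbitrary: a)
    case (Suc k)
    then have "(w, x) \<in> {(a, b). E a b} ^^ k \<Longrightarrow> E x a = E' x a" for x
      using edge'[of x k a] by simp
    then show ?case using Suc by (auto simp: relcomp_unfold)
  qed simp
  have in_ball: "ball_of V E s w = ball_of V' E' s w" if "s \<le> t" for s
    using path that relpow_in_V[OF g(1) wV(1)] relpow_in_V[OF g(2) wV(2)]
    unfolding ball_of_def by (auto; meson order_trans)
  have sym: "E a b = E b a" "E' a b = E' b a" for a b
    using g unfolding simple_graph_def by auto
  have E_in: "E a b = E' a b" if "a \<in> ball_of V E (t - 1) w" "0 < t" for a b
    using that edge'[of a _ b] unfolding ball_of_def by fastforce
  show "local_view V E t w = local_view V' E' t w"
    unfolding local_view_def using in_ball[of t] in_ball[of "t - 1"] E_in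
    by (auto intro!: ext) (use sym in blast)+
qed

text \<open>Makes any labelling with \<open>loc t\<close> a function of the radius-t view, so that
  all later work can use \<open>loc\<close> alone.\<close>

lemma local_view_agree:
  assumes "simple_graph V E" "simple_graph V' E'" "v \<in> V" "v \<in> V'"
    and "local_view V E t v = local_view V' E' t v"
  shows "agree t E E' v"
  using assms(3-)
proof (induction t arbitrary: v)
  case (Suc t)
  then show ?case using local_view_nbr[OF assms(1,2) Suc.prems] by (metis agree.simps(2))
qed simp

section \<open>Functions with few agreements\<close>

lemma card_funcset_agree_on:
  fixes g :: "nat \<Rightarrow> nat"
  assumes "I \<subseteq> {..<a}"
  shows "card {f \<in> {..<a} \<rightarrow>\<^sub>E {..<b}. \<forall>i\<in>I. f i = g i} \<le> b ^ (a - card I)"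
proof -
  let ?B = "\<lambda>i. if i \<in> I then {g i} else {..<b}"
  have "{f \<in> {..<a} \<rightarrow>\<^sub>E {..<b}. \<forall>i\<in>I. f i = g i} \<subseteq> PiE {..<a} ?B"
    by (auto simp: PiE_def Pi_def)
  then have "card {f \<in> {..<a} \<rightarrow>\<^sub>E {..<b}. \<forall>i\<in>I. f i = g i} \<le> card (PiE {..<a} ?B)"
    by (intro card_mono finite_PiE) auto
  also have "\<dots> = (\<Prod>i<a. card (?B i))" by (simp add: card_PiE)
  also have "\<dots> = (\<Prod>i\<in>{..<a} - I. b)"
    by (intro prod.mono_neutral_cong_right) auto
  also have "\<dots> = b ^ (a - card I)"
    using assms by (simp add: card_Diff_subset finite_subset)
  finally show ?thesis .
qed

text \<open>A Gilbert--Varshamov argument: a uniformly random function agrees with a given one in more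
  than \<open>d\<close> places with probability at most \<open>(a choose (d + 1)) / (2 * a) ^ (d + 1) \<le> 2 ^ -(d + 1)\<close>.\<close>
lemma few_agreements_exists:
  fixes G :: "(nat \<Rightarrow> nat) set"
  assumes "finite G" "card G < 2 ^ (d + 1)" "0 < a"
  shows "\<exists>f. (\<forall>i. f i < 2 * a) \<and> (\<forall>g\<in>G. card {i. i < a \<and> f i = g i} \<le> d)"
proof -
  let ?F = "{..<a} \<rightarrow>\<^sub>E {..<2 * a}"
  let ?bad = "\<lambda>g. {f \<in> ?F. d < card {i. i < a \<and> f i = g i}}"
  have finF: "finite ?F" by (intro finite_PiE) auto
  have cardF: "card ?F = (2 * a) ^ a" by (simp add: card_PiE)
  have bad: "card (?bad g) * 2 ^ (d + 1) \<le> (2 * a) ^ a" for g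
  proof (cases "d + 1 \<le> a")
    case False
    have "card {i. i < a \<and> f i = g i} \<le> card {..<a}" for f by (rule card_mono) auto
    then have "card {i. i < a \<and> f i = g i} \<le> d" for f
      using False by (metis Suc_eq_plus1 card_lessThan le_trans not_less_eq_eq)
    then have "?bad g = {}" by (auto simp: not_less)
    then show ?thesis by (simp only: card.empty)
  next
    case True
    let ?S = "{I. I \<subseteq> {..<a} \<and> card I = d + 1}"
    have "?bad g \<subseteq> (\<Union>I\<in>?S. {f \<in> ?F. \<forall>i\<in>I. f i = g i})"
    proof
      fix f assume f: "f \<in> ?bad g"
      then have "d + 1 \<le> card {i. i < a \<and> f i = g i}" by simp
      then obtain I where "I \<subseteq> {i. i < a \<and> f i = g i}" "card I = d + 1"
        by (rule obtain_subset_with_card_n)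
      then have "I \<in> ?S" "f \<in> {f \<in> ?F. \<forall>i\<in>I. f i = g i}" using f by blast+
      then show "f \<in> (\<Union>I\<in>?S. {f \<in> ?F. \<forall>i\<in>I. f i = g i})" by (rule UN_I)
    qed
    moreover have finS: "finite ?S" by (rule finite_subset[of _ "Pow {..<a}"]) auto
    ultimately have "card (?bad g) \<le> card (\<Union>I\<in>?S. {f \<in> ?F. \<forall>i\<in>I. f i = g i})"
      using finF by (intro card_mono finite_UN_I) simp_all
    also have "\<dots> \<le> (\<Sum>I\<in>?S. card {f \<in> ?F. \<forall>i\<in>I. f i = g i})"
      by (rule card_UN_le[OF finS])
    also have "\<dots> \<le> (\<Sum>I\<in>?S. (2 * a) ^ (a - (d + 1)))"
    proof (rule sum_mono)
      fix I assume I: "I \<in> ?S"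
      show "card {f \<in> ?F. \<forall>i\<in>I. f i = g i} \<le> (2 * a) ^ (a - (d + 1))"
        using card_funcset_agree_on[of I a "2 * a" g] I by simp
    qed
    also have "\<dots> = (a choose (d + 1)) * (2 * a) ^ (a - (d + 1))"
      using n_subsets[of "{..<a}" "d + 1"] by simp
    also have "\<dots> \<le> a ^ (d + 1) * (2 * a) ^ (a - (d + 1))"
      using binomial_le_pow[OF True] by (rule mult_right_mono) simp
    finally have "card (?bad g) * 2 ^ (d + 1) \<le> (2 * a) ^ (d + 1) * (2 * a) ^ (a - (d + 1))"
      by (simp add: power_mult_distrib mult_ac)
    also have "\<dots> = (2 * a) ^ (d + 1 + (a - (d + 1)))" by (rule power_add[symmetric])
    also have "\<dots> = (2 * a) ^ a" using True by simp
    finally show ?thesis .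
  qed
  define B where "B = (\<Union>g\<in>G. ?bad g)"
  have "card B \<le> (\<Sum>g\<in>G. card (?bad g))"
    unfolding B_def by (rule card_UN_le[OF assms(1)])
  then have "card B * 2 ^ (d + 1) \<le> (\<Sum>g\<in>G. card (?bad g)) * 2 ^ (d + 1)" by (rule mult_right_mono) simp
  also have "\<dots> = (\<Sum>g\<in>G. card (?bad g) * 2 ^ (d + 1))" by (rule sum_distrib_right)
  also have "\<dots> \<le> (\<Sum>g\<in>G. (2 * a) ^ a)" by (rule sum_mono) (rule bad)
  also have "\<dots> = card G * (2 * a) ^ a" by simp
  also have "\<dots> < 2 ^ (d + 1) * (2 * a) ^ a"
    using assms(2,3) by (intro mult_strict_right_mono) simp_all
  finally have "card B < card ?F"
    unfolding cardF by (metis mult.commute mult_less_cancel2)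
  moreover have "finite B"
    unfolding B_def using finF by (intro finite_UN_I assms(1)) simp
  ultimately have "\<not> ?F \<subseteq> B" using card_mono[of B ?F] by linarith
  then obtain f where f: "f \<in> ?F" "\<forall>g\<in>G. f \<notin> ?bad g" unfolding B_def by blast
  \<comment> \<open>Extensional functions are \<open>undefined\<close> outside the domain; the value
    0 there keeps the bound 2 * a for every argument.\<close>
  let ?f = "\<lambda>i. if i < a then f i else 0"
  have "{i. i < a \<and> ?f i = g i} = {i. i < a \<and> f i = g i}" for g by auto
  then have "\<forall>g\<in>G. card {i. i < a \<and> ?f i = g i} \<le> d"
    using f by (metis (mono_tags, lifting) mem_Collect_eq not_less)
  moreover have "\<forall>i. ?f i < 2 * a" using f(1) assms(3) by (auto simp: PiE_def Pi_def)
  ultimately show ?thesis by (intro exI[of _ ?f] conjI)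
qed

text \<open>Having the constant function \<open>0\<close> in the family makes the bound on shifted agreements also bound
  how often a member takes any given value.\<close>
lemma few_agreements_family:
  assumes "0 < a" "m * z < 2 ^ (d + 1)"
  shows "\<exists>f :: nat \<Rightarrow> nat \<Rightarrow> nat. f 0 = (\<lambda>_. 0) \<and> (\<forall>c i. f c i < 2 * a) \<and>
    (\<forall>c<m. \<forall>c'<c. \<forall>s<z. card {i. i < a \<and> f c i = (f c' i + s) mod (2 * a)} \<le> d)"
  using assms(2)
proof (induction m)
  case 0
  then show ?case using assms(1) by (intro exI[of _ "\<lambda>_ _. 0"]) auto
next
  case (Suc m)
  then obtain f :: "nat \<Rightarrow> nat \<Rightarrow> nat" where f: "f 0 = (\<lambda>_. 0)" "\<And>c i. f c i < 2 * a"
    "\<And>c c' s. c < m \<Longrightarrow> c' < c \<Longrightarrow> s < z \<Longrightarrow> card {i. i < a \<and> f c i = (f c' i + s) mod (2 * a)} \<le> d"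
    by auto
  show ?case
  \<comment> \<open>The first member is the zero function itself, so nothing has to be found for it.
    Each later one must avoid all z shifts of all m predecessors.\<close>
  proof (cases "m = 0")
    case True
    then show ?thesis using f by (intro exI[of _ f]) auto
  next
    case False
    let ?G = "(\<lambda>(c', s) i. (f c' i + s) mod (2 * a)) ` ({..<m} \<times> {..<z})"
    have "card ?G \<le> m * z" using card_image_le[of "{..<m} \<times> {..<z}"] by (simp add: card_cartesian_product)
    then have card_G: "card ?G < 2 ^ (d + 1)" using Suc.prems by simp
    have "finite ?G" by simp
    from few_agreements_exists[OF this card_G assms(1)]
    obtain h where h: "(\<forall>i. h i < 2 * a) \<and> (\<forall>g\<in>?G. card {i. i < a \<and> h i = g i} \<le> d)"
      by (rule exE)
    have "card {i. i < a \<and> h i = (f c' i + s) mod (2 * a)} \<le> d" if "c' < m" "s < z" for c' s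
    proof -
      have "(\<lambda>i. (f c' i + s) mod (2 * a)) \<in> ?G"
        using that by (intro image_eqI[of _ _ "(c', s)"]) simp_all
      from bspec[OF conjunct2[OF h] this] show ?thesis .
    qed
    then show ?thesis
      using f(1,2,3) conjunct1[OF h] False by (intro exI[of _ "f(m := h)"]) (auto simp: less_Suc_eq)
  qed
qed

text \<open>The clause on single values is for neighbours that have settled: such a neighbour holds
  one fixed value instead of moving along its function.\<close>

definition spread :: "(nat \<Rightarrow> nat \<Rightarrow> nat) \<Rightarrow> nat \<Rightarrow> nat \<Rightarrow> nat \<Rightarrow> bool" where
  "spread f m a d \<longleftrightarrow> (\<forall>c i. f c i < 2 * a) \<and>
    (\<forall>c<m. \<forall>c'<m. c \<noteq> c' \<longrightarrow> (\<forall>s. card {i. i < a \<and> f c i = (f c' i + s) mod (2 * a)} \<le> d)) \<and>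
    (\<forall>c<m. \<forall>y. card {i. i < a \<and> f c i = y} \<le> d)"

lemma spread_less: "spread f m a d \<Longrightarrow> f c i < 2 * a"
  and spread_agree: "spread f m a d \<Longrightarrow> c < m \<Longrightarrow> c' < m \<Longrightarrow> c \<noteq> c' \<Longrightarrow>
    card {i. i < a \<and> f c i = (f c' i + s) mod (2 * a)} \<le> d"
  and spread_value: "spread f m a d \<Longrightarrow> c < m \<Longrightarrow> card {i. i < a \<and> f c i = y} \<le> d"
  unfolding spread_def by blast+

lemma mod_shift_swap:
  fixes x y s b :: nat
  assumes "x = (y + s) mod b" "y < b" "s < b"
  shows "y = (x + (b - s)) mod b"
proof -
  have "(x + (b - s)) mod b = (y + s + (b - s)) mod b" using assms(1) by (simp add: mod_simps)
  also have "\<dots> = y" using assms by simp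
  finally show ?thesis by simp
qed

text \<open>The zero function is dropped after it has served to bound single values, hence m + 1 and
  \<open>Suc\<close>. Agreement with a function shifted by s is agreement of that function with the
  first one shifted by 2 * a - s, which removes the order on the indices.\<close>

lemma spread_exists:
  assumes "0 < a" "(m + 1) * (2 * a) < 2 ^ (d + 1)"
  shows "\<exists>f. spread f m a d"
proof -
  obtain f :: "nat \<Rightarrow> nat \<Rightarrow> nat" where f: "f 0 = (\<lambda>_. 0)" "\<And>c i. f c i < 2 * a"
    "\<And>c c' s. c < m + 1 \<Longrightarrow> c' < c \<Longrightarrow> s < 2 * a \<Longrightarrow>
       card {i. i < a \<and> f c i = (f c' i + s) mod (2 * a)} \<le> d"
    using few_agreements_family[OF assms] by blast
  let ?f = "\<lambda>c. f (Suc c)"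
  have less: "card {i. i < a \<and> ?f c i = (?f c' i + s) mod (2 * a)} \<le> d"
    if "c < m" "c' < c" for c c' s
    using f(3)[of "Suc c" "Suc c'" "s mod (2 * a)"] that assms(1) by (simp add: mod_simps)
  have greater: "card {i. i < a \<and> ?f c i = (?f c' i + s) mod (2 * a)} \<le> d"
    if "c' < m" "c < c'" for c c' s
  proof -
    have "{i. i < a \<and> ?f c i = (?f c' i + s) mod (2 * a)} \<subseteq>
          {i. i < a \<and> ?f c' i = (?f c i + (2 * a - s mod (2 * a))) mod (2 * a)}"
      using f(2) mod_shift_swap[of "?f c _" "?f c' _" "s mod (2 * a)" "2 * a"] assms(1)
      by (auto simp: mod_simps)
    then have "card {i. i < a \<and> ?f c i = (?f c' i + s) mod (2 * a)} \<le>
          card {i. i < a \<and> ?f c' i = (?f c i + (2 * a - s mod (2 * a))) mod (2 * a)}"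
      by (intro card_mono) auto
    then show ?thesis using less[OF that] le_trans by blast
  qed
  have const: "card {i. i < a \<and> ?f c i = y} \<le> d" if "c < m" for c y
  proof (cases "y < 2 * a")
    case True
    then show ?thesis using f(3)[of "Suc c" 0 y] that f(1) by simp
  next
    case False
    then have "{i. i < a \<and> ?f c i = y} = {}" using f(2) by auto
    then show ?thesis by (simp only: card.empty)
  qed
  show ?thesis
    unfolding spread_def using f(2) less greater const
    by (intro exI[of _ ?f]) (metis (no_types, lifting) linorder_neqE_nat)
qed

section \<open>Colour reduction\<close>

text \<open>A colour \<open>x < 2 * a * a\<close> stands for the grid point \<open>(x div (2 * a), x mod (2 * a))\<close>; the set is the
  graph of \<open>f c\<close> shifted cyclically by \<open>s\<close>.\<close>
definition graph_pts :: "(nat \<Rightarrow> nat \<Rightarrow> nat) \<Rightarrow> nat \<Rightarrow> nat \<Rightarrow> nat \<Rightarrow> nat set" where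
  "graph_pts f a c s = {x. x < 2 * a * a \<and> x mod (2 * a) = (f c (x div (2 * a)) + s) mod (2 * a)}"

lemma finite_graph_pts [simp]: "finite (graph_pts f a c s)"
  by (simp add: graph_pts_def)

lemma card_graph_pts_ge: "a \<le> card (graph_pts f a c s)"
proof -
  let ?g = "\<lambda>i. i * (2 * a) + (f c i + s) mod (2 * a)"
  have dm: "?g i div (2 * a) = i" "?g i mod (2 * a) = (f c i + s) mod (2 * a)" if "i < a" for i
    using that by auto
  have less: "?g i < 2 * a * a" if "i < a" for i
  proof -
    have "?g i < Suc i * (2 * a)" using that by simp
    also have "\<dots> \<le> a * (2 * a)" using that by (intro mult_right_mono) auto
    finally show ?thesis by (simp add: mult_ac)
  qed
  have "inj_on ?g {..<a}" by (rule inj_on_inverseI[where g = "\<lambda>x. x div (2 * a)"]) (rule dm, simp)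
  moreover have "?g i \<in> graph_pts f a c s" if "i < a" for i
    unfolding graph_pts_def mem_Collect_eq dm[OF that] using less[OF that] by (intro conjI refl)
  then have "?g ` {..<a} \<subseteq> graph_pts f a c s" by (auto simp only: image_subset_iff lessThan_iff)
  ultimately show ?thesis using card_inj_on_le[of ?g "{..<a}" "graph_pts f a c s"] by simp
qed

text \<open>Each column holds at most one common point, and there the two functions agree up to the
  difference of the shifts. The bound on s makes the natural subtraction 2 * a - s genuine.\<close>

lemma card_graph_pts_Int_le:
  assumes f: "\<And>c i. f c i < 2 * a" and s: "s < 2 * a"
  shows "card (graph_pts f a c s \<inter> graph_pts f a c' s') \<le>
    card {i. i < a \<and> f c i = (f c' i + (s' + (2 * a - s))) mod (2 * a)}"
proof (rule card_inj_on_le)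
  let ?D = "\<lambda>x. x div (2 * a)"
  show "inj_on ?D (graph_pts f a c s \<inter> graph_pts f a c' s')"
  proof (rule inj_onI)
    fix x y assume xy: "x \<in> graph_pts f a c s \<inter> graph_pts f a c' s'" "y \<in> graph_pts f a c s \<inter> graph_pts f a c' s'"
      and eq: "x div (2 * a) = y div (2 * a)"
    have "x mod (2 * a) = (f c (x div (2 * a)) + s) mod (2 * a)"
      "y mod (2 * a) = (f c (y div (2 * a)) + s) mod (2 * a)"
      using xy unfolding graph_pts_def by blast+
    then have "x mod (2 * a) = y mod (2 * a)" using eq by simp
    then show "x = y" using eq by (metis div_mult_mod_eq)
  qed
  show "?D ` (graph_pts f a c s \<inter> graph_pts f a c' s') \<subseteq>
    {i. i < a \<and> f c i = (f c' i + (s' + (2 * a - s))) mod (2 * a)}"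
  proof
    fix i assume "i \<in> ?D ` (graph_pts f a c s \<inter> graph_pts f a c' s')"
    then obtain x where x0: "i = x div (2 * a)" "x \<in> graph_pts f a c s" "x \<in> graph_pts f a c' s'" by blast
    have x: "i = x div (2 * a)" "x < 2 * a * a"
      "(f c i + s) mod (2 * a) = (f c' i + s') mod (2 * a)"
      using x0 unfolding graph_pts_def by simp_all
    have "(f c i + s + (2 * a - s)) mod (2 * a) = (f c' i + s' + (2 * a - s)) mod (2 * a)"
      using x(3) by (metis mod_add_left_eq)
    moreover have "(f c i + s + (2 * a - s)) mod (2 * a) = f c i" using f[of c i] s by simp
    moreover have "i < a" using x s by (simp add: div_less_iff_less_mult mult_ac)
    ultimately show "i \<in> {i. i < a \<and> f c i = (f c' i + (s' + (2 * a - s))) mod (2 * a)}"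
      by (simp add: add.assoc)
  qed
qed simp

text \<open>The 2 * a cyclic shifts of one graph cover the grid, so some shift contains at least the
  average share of L.\<close>

lemma graph_pts_shift_exists:
  assumes f: "\<And>c i. f c i < 2 * a" and L: "L \<subseteq> {..<2 * a * a}" and "0 < a"
  shows "\<exists>s<2 * a. card L \<le> 2 * a * card (L \<inter> graph_pts f a c s)"
proof (rule ccontr)
  assume "\<not> ?thesis"
  then have less: "2 * a * card (L \<inter> graph_pts f a c s) < card L" if "s < 2 * a" for s
    using that by (meson not_less)
  have "L \<subseteq> (\<Union>s<2 * a. L \<inter> graph_pts f a c s)"
  proof
    fix x assume x: "x \<in> L"
    let ?s = "(x mod (2 * a) + (2 * a - f c (x div (2 * a)))) mod (2 * a)"
    have "(f c (x div (2 * a)) + ?s) mod (2 * a) =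
      (f c (x div (2 * a)) + (x mod (2 * a) + (2 * a - f c (x div (2 * a))))) mod (2 * a)"
      by (rule mod_add_right_eq)
    also have "\<dots> = (x mod (2 * a) + 2 * a) mod (2 * a)"
      using f[of c "x div (2 * a)"] by (intro arg_cong[where f = "\<lambda>y. y mod (2 * a)"]) linarith
    also have "\<dots> = x mod (2 * a)" by simp
    finally have "x \<in> graph_pts f a c ?s" using x L unfolding graph_pts_def by auto
    moreover have "?s < 2 * a" using \<open>0 < a\<close> by simp
    ultimately show "x \<in> (\<Union>s<2 * a. L \<inter> graph_pts f a c s)" using x by blast
  qed
  moreover have "finite L" using L finite_subset by blast
  ultimately have "card L \<le> card (\<Union>s<2 * a. L \<inter> graph_pts f a c s)" by (intro card_mono) auto
  also have "\<dots> \<le> (\<Sum>s<2 * a. card (L \<inter> graph_pts f a c s))" by (rule card_UN_le) simp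
  finally have "2 * a * card L \<le> (\<Sum>s<2 * a. 2 * a * card (L \<inter> graph_pts f a c s))"
    unfolding sum_distrib_left[symmetric] by simp
  also have "\<dots> < (\<Sum>s<2 * a. card L)"
    using less \<open>0 < a\<close> by (intro sum_strict_mono) (auto simp: lessThan_empty_iff)
  finally show False by simp
qed

text \<open>Derived graphs are carried as neighbour sets over all natural numbers, so that no vertex
  set has to be passed around.\<close>

definition nbr_graph :: "(nat \<Rightarrow> nat set) \<Rightarrow> nat \<Rightarrow> bool" where
  "nbr_graph H \<delta> \<longleftrightarrow> (\<forall>v. finite (H v) \<and> card (H v) \<le> \<delta> \<and> (\<forall>w\<in>H v. v \<in> H w))"

definition colors :: "(nat \<Rightarrow> nat set) \<Rightarrow> nat \<Rightarrow> (nat \<Rightarrow> nat) \<Rightarrow> bool" where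
  "colors H m c \<longleftrightarrow> (\<forall>v. c v < m \<and> (\<forall>w\<in>H v. c v \<noteq> c w))"

text \<open>Ensures that one round on the derived graph is simulated by one round on the
  network.\<close>

definition sub_nbrs :: "((nat \<Rightarrow> nat \<Rightarrow> bool) \<Rightarrow> nat \<Rightarrow> nat set) \<Rightarrow> bool" where
  "sub_nbrs H \<longleftrightarrow> (\<forall>E v. \<forall>w\<in>H E v. E v w)"

lemma locD_sub:
  assumes "loc r F" "sub_nbrs H" "agree s E E' v" "r < s" "w \<in> H E v"
  shows "F E w = F E' w"
  using assms locD_nbr[OF assms(1,3,4)] unfolding sub_nbrs_def by blast

lemma exists_avoiding_small_overlaps:
  assumes "finite A" "\<And>u. u \<in> U \<Longrightarrow> card (A \<inter> B u) \<le> d" "finite U" "card U * d < card A"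
  shows "\<exists>x\<in>A. \<forall>u\<in>U. x \<notin> B u"
proof (rule ccontr)
  assume "\<not> ?thesis"
  then have "A \<subseteq> (\<Union>u\<in>U. A \<inter> B u)" by blast
  then have "card A \<le> card (\<Union>u\<in>U. A \<inter> B u)" using assms(1,3) by (intro card_mono) auto
  also have "\<dots> \<le> (\<Sum>u\<in>U. card (A \<inter> B u))" by (rule card_UN_le[OF assms(3)])
  also have "\<dots> \<le> card U * d" using sum_bounded_above[of U "\<lambda>u. card (A \<inter> B u)" d] assms(2) by simp
  finally show False using assms(4) by simp
qed

text \<open>Linial's step: a colour is read as a function whose graph has at least a = \<Delta> * d
  + 1 points, and at most \<Delta> neighbours cover at most d of them each. A remaining point is the
  new colour; it lies on the vertex's own graph and on no neighbour's, so neighbours differ. Only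
  the shift 0 occurs here.\<close>

lemma linial_step:
  assumes H: "loc r H" "sub_nbrs H" and c: "loc r c" and m: "m < 2 ^ (d + 1)"
  shows "\<exists>c'. loc (Suc r) c' \<and> (\<forall>E. nbr_graph (H E) \<Delta> \<longrightarrow> colors (H E) m (c E) \<longrightarrow>
    colors (H E) (2 * (\<Delta> * d + 1) ^ 2) (c' E))"
proof -
  define a where "a = \<Delta> * d + 1"
  have a: "0 < a" by (simp add: a_def)
  obtain f :: "nat \<Rightarrow> nat \<Rightarrow> nat" where f0: "f 0 = (\<lambda>_. 0) \<and> (\<forall>c i. f c i < 2 * a) \<and>
    (\<forall>c<m. \<forall>c'<c. \<forall>s<1. card {i. i < a \<and> f c i = (f c' i + s) mod (2 * a)} \<le> d)"
    using few_agreements_family[OF a, of m 1 d] m by (elim meta_impE exE) simp_all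
  have f: "f c i < 2 * a" for c i using f0 by blast
  have f_less: "card {i. i < a \<and> f c i = f c' i} \<le> d" if "c < m" "c' < c" for c c'
    using f0 that f by simp
  have inter: "card (graph_pts f a c 0 \<inter> graph_pts f a c' 0) \<le> d" if "c < m" "c' < m" "c \<noteq> c'" for c c'
  proof (cases "c' < c")
    case True
    have "card (graph_pts f a c 0 \<inter> graph_pts f a c' 0) \<le> card {i. i < a \<and> f c i = f c' i}"
      using card_graph_pts_Int_le[OF f, where s = 0 and c = c and c' = c' and s' = 0] a f by simp
    then show ?thesis using f_less[OF that(1) True] by simp
  next
    case False
    have "card (graph_pts f a c' 0 \<inter> graph_pts f a c 0) \<le> card {i. i < a \<and> f c' i = f c i}"
      using card_graph_pts_Int_le[OF f, where s = 0 and c = c' and c' = c and s' = 0] a f by simp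
    then show ?thesis using f_less[OF that(2), of c] that False by (simp add: Int_commute)
  qed
  define P where "P E v x \<longleftrightarrow> x \<in> graph_pts f a (c E v) 0 \<and> (\<forall>u\<in>H E v. x \<notin> graph_pts f a (c E u) 0)" for E v x
  \<comment> \<open>\<open>SOME\<close> returns equal values for equal predicates, so the choice is
    local as soon as \<open>P\<close> is. The same device is used for all later choices.\<close>
  define c' where "c' E v = (SOME x. P E v x)" for E v
  have "loc (Suc r) c'"
  proof (rule locI)
    fix E E' v assume ag: "agree (Suc r) E E' v"
    have "H E v = H E' v" "c E v = c E' v" using locD[OF H(1) ag] locD[OF c ag] by auto
    moreover have "c E w = c E' w" if "w \<in> H E v" for w
      using locD_sub[OF c H(2) ag _ that] by simp
    ultimately have "P E v = P E' v" unfolding P_def by auto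
    then show "c' E v = c' E' v" unfolding c'_def by simp
  qed
  moreover have "colors (H E) (2 * a ^ 2) (c' E)"
    if g: "nbr_graph (H E) \<Delta>" and pr: "colors (H E) m (c E)" for E
  proof -
    have P: "P E v (c' E v)" for v
    proof -
      have "card (H E v) * d \<le> \<Delta> * d" using g by (simp add: nbr_graph_def)
      then have "card (H E v) * d < card (graph_pts f a (c E v) 0)"
        using card_graph_pts_ge[of a f "c E v" 0] a_def by linarith
      then have "\<exists>x\<in>graph_pts f a (c E v) 0. \<forall>u\<in>H E v. x \<notin> graph_pts f a (c E u) 0"
      proof (rule exists_avoiding_small_overlaps[rotated -1])
        show "card (graph_pts f a (c E v) 0 \<inter> graph_pts f a (c E u) 0) \<le> d" if "u \<in> H E v" for u
          using pr that by (intro inter) (auto simp: colors_def)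
      qed (use g in \<open>auto simp: nbr_graph_def\<close>)
      then have "\<exists>x. P E v x" unfolding P_def by blast
      then show ?thesis unfolding c'_def by (rule someI_ex)
    qed
    have "c' E v \<noteq> c' E w" if "w \<in> H E v" for v w
      using P[of v] P[of w] that unfolding P_def by metis
    moreover have "c' E v < 2 * a ^ 2" for v
      using P[of v] unfolding P_def graph_pts_def by (simp add: power2_eq_square mult_ac)
    ultimately show ?thesis unfolding colors_def by simp
  qed
  ultimately show ?thesis unfolding a_def by blast
qed

section \<open>Colouring with one more colour than the degree\<close>

definition candidate :: "(nat \<Rightarrow> nat \<Rightarrow> nat) \<Rightarrow> (nat \<Rightarrow> nat) \<Rightarrow> (nat \<Rightarrow> nat option) \<Rightarrow> nat \<Rightarrow> nat \<Rightarrow> nat" where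
  "candidate f c \<sigma> t u = f (c u) (case \<sigma> u of None \<Rightarrow> t | Some s \<Rightarrow> s)"

text \<open>The value \<open>Some t\<close> is the time at which a vertex settles; the class it joins is its candidate then.\<close>
primrec settle :: "(nat \<Rightarrow> nat \<Rightarrow> nat) \<Rightarrow> nat \<Rightarrow> (nat \<Rightarrow> nat set) \<Rightarrow> (nat \<Rightarrow> nat) \<Rightarrow> nat \<Rightarrow> nat \<Rightarrow> nat option" where
  "settle f \<beta> H c 0 = (\<lambda>v. None)"
| "settle f \<beta> H c (Suc t) = (\<lambda>v.
     if settle f \<beta> H c t v = None \<and> card {u \<in> H v. candidate f c (settle f \<beta> H c t) t u = f (c v) t} \<le> \<beta>
     then Some t else settle f \<beta> H c t v)"

lemma loc_settle:
  assumes H: "loc r H" "sub_nbrs H" and c: "loc r c"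
  shows "loc (r + t) (\<lambda>E. settle f \<beta> (H E) (c E) t)"
proof (induction t)
  case 0
  show ?case by (rule locI) simp
next
  case (Suc t)
  show ?case
  proof (rule locI)
    fix E E' v assume ag: "agree (r + Suc t) E E' v"
    have eq: "H E v = H E' v" "c E v = c E' v" "settle f \<beta> (H E) (c E) t v = settle f \<beta> (H E') (c E') t v"
      using locD[OF H(1) ag] locD[OF c ag] locD[OF Suc ag] by auto
    have "c E w = c E' w" "settle f \<beta> (H E) (c E) t w = settle f \<beta> (H E') (c E') t w" if "w \<in> H E v" for w
      using locD_sub[OF c H(2) ag _ that] locD_sub[OF Suc H(2) ag _ that] by auto
    then have "{u \<in> H E v. candidate f (c E) (settle f \<beta> (H E) (c E) t) t u = f (c E v) t} =
       {u \<in> H E' v. candidate f (c E') (settle f \<beta> (H E') (c E') t) t u = f (c E' v) t}"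
      using eq by (auto simp: candidate_def)
    then show "settle f \<beta> (H E) (c E) (Suc t) v = settle f \<beta> (H E') (c E') (Suc t) v"
      using eq by simp
  qed
qed

lemma settle_mono: "settle f \<beta> H c t v = Some s \<Longrightarrow> t \<le> t' \<Longrightarrow> settle f \<beta> H c t' v = Some s"
  by (induction t' rule: nat_induct) (auto simp: le_Suc_eq)

lemma settle_SomeD:
  assumes "settle f \<beta> H c t v = Some s"
  shows "s < t \<and> settle f \<beta> H c s v = None \<and> card {u \<in> H v. candidate f c (settle f \<beta> H c s) s u = f (c v) s} \<le> \<beta>"
  using assms by (induction t) (auto split: if_splits)

lemma settle_None_before:
  assumes "settle f \<beta> H c a u = Some s" "t \<le> s"
  shows "settle f \<beta> H c t u = None"
  using settle_SomeD[OF assms(1)] settle_mono[OF _ assms(2), of f \<beta> H c u]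
  by (cases "settle f \<beta> H c t u") auto

lemma settle_Some_after:
  assumes "settle f \<beta> H c a u = Some s" "s < t"
  shows "settle f \<beta> H c t u = Some s"
proof (cases "t \<le> a")
  case True
  have *: "settle f \<beta> H c (Suc s) u = Some s"
    using settle_SomeD[OF assms(1)] by simp
  then show ?thesis using settle_mono[OF *, of t] assms(2) by simp
next
  case False
  then show ?thesis using settle_mono[OF assms(1), of t] by simp
qed

text \<open>Against a fixed neighbour, the candidates of a vertex collide at most \<open>d\<close> times while
  the neighbour is undecided and at most \<open>d\<close> times after it has settled on a value; averaging over
  the \<open>a\<close> time steps yields one with few collisions.\<close>
lemma settle_terminates:
  assumes sp: "spread f m a d" and col: "colors U m c" and g: "nbr_graph U \<theta>"
    and ab: "2 * d * \<theta> < a * (\<beta> + 1)"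
  shows "\<exists>s<a. settle f \<beta> U c a v = Some s"
proof (cases "settle f \<beta> U c a v")
  case (Some s)
  then show ?thesis using settle_SomeD[OF Some] by simp
next
  case None
  let ?\<sigma> = "settle f \<beta> U c"
  define hit where "hit t u \<longleftrightarrow> candidate f c (?\<sigma> t) t u = f (c v) t" for t u
  have none: "?\<sigma> t v = None" if "t \<le> a" for t
    using None settle_mono[of f \<beta> U c t v _ a] that by (cases "?\<sigma> t v") auto
  have many: "\<beta> + 1 \<le> card {u \<in> U v. hit t u}" if "t < a" for t
    using none[of "Suc t"] that by (auto simp: hit_def split: if_splits)
  have finU: "finite (U v)" and cU: "card (U v) \<le> \<theta>" using g by (auto simp: nbr_graph_def)
  have few: "card {t. t < a \<and> hit t u} \<le> 2 * d" if u: "u \<in> U v" for u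
  proof -
    have cu: "c u < m" "c v < m" "c v \<noteq> c u" using col u by (auto simp: colors_def)
    have A: "card {t. t < a \<and> f (c v) t = f (c u) t} \<le> d"
      using spread_agree[OF sp cu(2,1,3), of 0] spread_less[OF sp] by simp
    show ?thesis
    proof (cases "?\<sigma> a u")
      case None
      have "?\<sigma> t u = None" if "t < a" for t
        using None settle_mono[of f \<beta> U c t u _ a] that by (cases "?\<sigma> t u") auto
      then have "{t. t < a \<and> hit t u} \<subseteq> {t. t < a \<and> f (c v) t = f (c u) t}"
        by (auto simp: hit_def candidate_def)
      then have "card {t. t < a \<and> hit t u} \<le> card {t. t < a \<and> f (c v) t = f (c u) t}"
        by (intro card_mono) auto
      then show ?thesis using A by linarith
    next
      case (Some s)
      have B: "card {t. t < a \<and> f (c v) t = f (c u) s} \<le> d"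
        by (rule spread_value[OF sp cu(2)])
      have "hit t u \<Longrightarrow> f (c v) t = f (c u) t \<or> f (c v) t = f (c u) s" for t
        using settle_None_before[OF Some, of t] settle_Some_after[OF Some, of t]
        by (cases "t \<le> s") (auto simp: hit_def candidate_def)
      then have "{t. t < a \<and> hit t u} \<subseteq>
          {t. t < a \<and> f (c v) t = f (c u) t} \<union> {t. t < a \<and> f (c v) t = f (c u) s}"
        by blast
      then have "card {t. t < a \<and> hit t u} \<le>
          card ({t. t < a \<and> f (c v) t = f (c u) t} \<union> {t. t < a \<and> f (c v) t = f (c u) s})"
        by (intro card_mono) auto
      also have "\<dots> \<le> d + d"
        by (rule order_trans[OF card_Un_le add_mono[OF A B]])
      finally show ?thesis by simp
    qed
  qed
  have "a * (\<beta> + 1) = (\<Sum>t<a. \<beta> + 1)" by simp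
  also have "\<dots> \<le> (\<Sum>t<a. card {u \<in> U v. hit t u})" by (rule sum_mono) (use many in auto)
  also have "\<dots> = (\<Sum>t<a. \<Sum>u\<in>U v. if hit t u then 1 else 0)"
    using finU by (intro sum.cong refl) (simp add: sum.If_cases Int_def)
  also have "\<dots> = (\<Sum>u\<in>U v. \<Sum>t<a. if hit t u then 1 else 0)" by (rule sum.swap)
  also have "\<dots> = (\<Sum>u\<in>U v. card {t. t < a \<and> hit t u})"
    by (intro sum.cong refl) (simp add: sum.If_cases Int_def)
  also have "\<dots> \<le> card (U v) * (2 * d)"
    using sum_bounded_above[of "U v" "\<lambda>u. card {t. t < a \<and> hit t u}" "2 * d"] few by simp
  also have "\<dots> \<le> \<theta> * (2 * d)" using cU by (rule mult_right_mono) simp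
  finally show ?thesis using ab by (simp add: mult_ac)
qed

text \<open>An edge inside a class is oriented towards the endpoint that settled first, and in both directions in
  case of a tie.\<close>
lemma settle_outdegree:
  assumes fin: "\<And>v. \<exists>s<a. settle f \<beta> U c a v = Some s" and g: "nbr_graph U \<theta>"
    and \<tau>: "\<And>v. \<tau> v = the (settle f \<beta> U c a v)"
  shows "card {u \<in> U v. \<tau> u \<le> \<tau> v \<and> f (c u) (\<tau> u) = f (c v) (\<tau> v)} \<le> \<beta>"
proof -
  have S: "settle f \<beta> U c a u = Some (\<tau> u)" for u using fin[of u] \<tau>[of u] by auto
  let ?\<sigma> = "settle f \<beta> U c (\<tau> v)"
  \<comment> \<open>At time \<open>\<tau> v\<close> a neighbour that settled earlier is frozen at
    its class, and one that settles at the same time is trying exactly the value it will keep. Both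
    were therefore counted when v settled.\<close>
  have "{u \<in> U v. \<tau> u \<le> \<tau> v \<and> f (c u) (\<tau> u) = f (c v) (\<tau> v)} \<subseteq>
        {u \<in> U v. candidate f c ?\<sigma> (\<tau> v) u = f (c v) (\<tau> v)}"
    using settle_None_before[OF S] settle_Some_after[OF S]
    by (auto simp: candidate_def le_less)
  moreover have "finite {u \<in> U v. candidate f c ?\<sigma> (\<tau> v) u = f (c v) (\<tau> v)}"
    using g by (simp add: nbr_graph_def)
  ultimately show ?thesis using settle_SomeD[OF S, of v] card_mono le_trans by blast
qed

section \<open>Simultaneous colour choice inside the classes\<close>

definition free_colors :: "nat \<Rightarrow> (nat \<Rightarrow> nat set) \<Rightarrow> (nat \<Rightarrow> nat option) \<Rightarrow> nat \<Rightarrow> nat set" where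
  "free_colors M H col v = {x. x < M \<and> (\<forall>u\<in>H v. col u \<noteq> Some x)}"

definition uncolored :: "(nat \<Rightarrow> nat set) \<Rightarrow> (nat \<Rightarrow> nat option) \<Rightarrow> nat \<Rightarrow> nat set" where
  "uncolored H col v = {u \<in> H v. col u = None}"

definition partial_coloring :: "(nat \<Rightarrow> nat set) \<Rightarrow> nat \<Rightarrow> (nat \<Rightarrow> nat option) \<Rightarrow> bool" where
  "partial_coloring H M col \<longleftrightarrow> (\<forall>v x. col v = Some x \<longrightarrow> x < M \<and> (\<forall>u\<in>H v. col u \<noteq> Some x))"

definition extends :: "(nat \<Rightarrow> nat option) \<Rightarrow> (nat \<Rightarrow> nat option) \<Rightarrow> bool" where
  "extends col' col \<longleftrightarrow> (\<forall>v x. col v = Some x \<longrightarrow> col' v = Some x)"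

lemma extends_None: "extends col' col \<Longrightarrow> col' v = None \<Longrightarrow> col v = None"
  unfolding extends_def by (metis not_None_eq)

lemma card_uncolored_extends:
  assumes "extends col' col" "finite (H v)"
  shows "card (uncolored H col' v) \<le> card (uncolored H col v)"
  using assms extends_None[OF assms(1)] unfolding uncolored_def by (intro card_mono) auto

text \<open>The palette exceeds the degree by one, and each coloured neighbour removes at most one
  colour.\<close>

lemma card_free_colors_gt_uncolored:
  assumes "nbr_graph H \<delta>"
  shows "card (uncolored H col v) < card (free_colors (\<delta> + 1) H col v)"
proof -
  have fin: "finite (H v)" and deg: "card (H v) \<le> \<delta>" using assms by (auto simp: nbr_graph_def)
  let ?C = "H v - uncolored H col v"
  have "{..<\<delta> + 1} \<subseteq> free_colors (\<delta> + 1) H col v \<union> (\<lambda>u. the (col u)) ` ?C"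
    unfolding free_colors_def uncolored_def by force
  moreover have fin_av: "finite (free_colors (\<delta> + 1) H col v)" by (simp add: free_colors_def)
  ultimately have "card {..<\<delta> + 1} \<le> card (free_colors (\<delta> + 1) H col v \<union> (\<lambda>u. the (col u)) ` ?C)"
    using fin by (intro card_mono) auto
  also have "\<dots> \<le> card (free_colors (\<delta> + 1) H col v) + card ?C"
    by (rule order_trans[OF card_Un_le add_left_mono[OF card_image_le]]) (use fin in auto)
  finally have "\<delta> + 1 \<le> card (free_colors (\<delta> + 1) H col v) + card ?C" by simp
  moreover have "card ?C = card (H v) - card (uncolored H col v)"
    using fin by (intro card_Diff_subset) (auto simp: uncolored_def)
  moreover have "card (uncolored H col v) \<le> card (H v)"
    using fin by (intro card_mono) (auto simp: uncolored_def)
  ultimately show ?thesis using deg by linarith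
qed

text \<open>First of two rounds per class: the published shift tells the neighbours which graph the
  vertex will choose from, and \<open>None\<close> means abstaining. The threshold \<theta>
  guarantees enough free colours.\<close>

definition announce :: "(nat \<Rightarrow> nat \<Rightarrow> nat) \<Rightarrow> nat \<Rightarrow> nat \<Rightarrow> nat \<Rightarrow> nat \<Rightarrow> (nat \<Rightarrow> nat set) \<Rightarrow> (nat \<Rightarrow> nat) \<Rightarrow>
    (nat \<Rightarrow> nat) \<Rightarrow> (nat \<Rightarrow> nat option) \<Rightarrow> nat \<Rightarrow> nat option" where
  "announce g a M \<theta> i H c b col v =
    (if col v = None \<and> b v = i \<and> \<theta> \<le> 2 * card (uncolored H col v)
     then Some (SOME s. s < 2 * a \<and>
       card (free_colors M H col v) \<le> 2 * a * card (free_colors M H col v \<inter> graph_pts g a (c v) s))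
     else None)"

text \<open>The whole graph of a participating out-neighbour is avoided, since its actual colour is
  being chosen in the same round.\<close>

definition commit :: "(nat \<Rightarrow> nat \<Rightarrow> nat) \<Rightarrow> nat \<Rightarrow> nat \<Rightarrow> (nat \<Rightarrow> nat set) \<Rightarrow> (nat \<Rightarrow> nat) \<Rightarrow>
    (nat \<Rightarrow> nat set) \<Rightarrow> (nat \<Rightarrow> nat option) \<Rightarrow> (nat \<Rightarrow> nat option) \<Rightarrow> nat \<Rightarrow> nat option" where
  "commit g a M H c Out col \<iota> v = (case \<iota> v of None \<Rightarrow> col v
    | Some s \<Rightarrow> Some (SOME x. x \<in> free_colors M H col v \<inter> graph_pts g a (c v) s \<and>
        (\<forall>u\<in>{u \<in> Out v. \<iota> u \<noteq> None}. x \<notin> graph_pts g a (c u) (the (\<iota> u)))))"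

lemma loc_announce:
  assumes H: "loc r H" "sub_nbrs H" and c: "loc r c" and b: "loc r b" and col: "loc r col"
  shows "loc (Suc r) (\<lambda>E. announce g a M \<theta> i (H E) (c E) (b E) (col E))"
proof (rule locI)
  fix E E' v assume ag: "agree (Suc r) E E' v"
  have eq: "H E v = H E' v" "c E v = c E' v" "b E v = b E' v" "col E v = col E' v"
    using locD[OF H(1) ag] locD[OF c ag] locD[OF b ag] locD[OF col ag] by auto
  have "col E w = col E' w" if "w \<in> H E v" for w
    using locD_sub[OF col H(2) ag _ that] by simp
  then have "uncolored (H E) (col E) v = uncolored (H E') (col E') v"
    "free_colors M (H E) (col E) v = free_colors M (H E') (col E') v"
    unfolding uncolored_def free_colors_def using eq by auto
  then show "announce g a M \<theta> i (H E) (c E) (b E) (col E) v = announce g a M \<theta> i (H E') (c E') (b E') (col E') v"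
    unfolding announce_def using eq by simp
qed

lemma loc_commit:
  assumes H: "loc r H" "sub_nbrs H" and c: "loc r c" and Out: "loc r Out" "sub_nbrs Out"
    and col: "loc r col" and \<iota>: "loc r \<iota>"
  shows "loc (Suc r) (\<lambda>E. commit g a M (H E) (c E) (Out E) (col E) (\<iota> E))"
proof (rule locI)
  fix E E' v assume ag: "agree (Suc r) E E' v"
  have eq: "H E v = H E' v" "c E v = c E' v" "Out E v = Out E' v" "col E v = col E' v" "\<iota> E v = \<iota> E' v"
    using locD[OF H(1) ag] locD[OF c ag] locD[OF Out(1) ag] locD[OF col ag] locD[OF \<iota> ag] by auto
  have "col E w = col E' w" if "w \<in> H E v" for w
    using locD_sub[OF col H(2) ag _ that] by simp
  then have av: "free_colors M (H E) (col E) v = free_colors M (H E') (col E') v"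
    unfolding free_colors_def using eq by auto
  have "c E w = c E' w" "\<iota> E w = \<iota> E' w" if "w \<in> Out E v" for w
    using locD_sub[OF c Out(2) ag _ that] locD_sub[OF \<iota> Out(2) ag _ that] by auto
  then have "(\<forall>u\<in>{u \<in> Out E v. \<iota> E u \<noteq> None}. x \<notin> graph_pts g a (c E u) (the (\<iota> E u))) \<longleftrightarrow>
    (\<forall>u\<in>{u \<in> Out E' v. \<iota> E' u \<noteq> None}. x \<notin> graph_pts g a (c E' u) (the (\<iota> E' u)))" for x
    using eq(3) by auto
  then show "commit g a M (H E) (c E) (Out E) (col E) (\<iota> E) v =
    commit g a M (H E') (c E') (Out E') (col E') (\<iota> E') v"
    unfolding commit_def using eq av by (simp only:)
qed

text \<open>Every edge between two participants is an out-edge of one endpoint, whose new colour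
  avoids the entire graph holding the other's new colour; so simultaneous choices cannot clash. A
  choice exists because the chosen shift holds more than \<theta> / (4 * a) \<ge> \<beta> * d free
  colours, while at most \<beta> out-neighbours block at most d each.\<close>

lemma commit_correct:
  assumes sp: "spread g m a d" and c: "colors H m c" and gr: "nbr_graph H \<delta>"
    and M: "\<delta> + 1 \<le> 2 * a * a" and col: "partial_coloring H (\<delta> + 1) col"
    and Out_sub: "\<And>v. Out v \<subseteq> H v" and Out_card: "\<And>v. card (Out v) \<le> \<beta>"
    and Out_total: "\<And>u v. u \<in> H v \<Longrightarrow> col u = None \<Longrightarrow> col v = None \<Longrightarrow> b u = b v \<Longrightarrow> u \<in> Out v \<or> v \<in> Out u"
    and \<beta>: "4 * a * \<beta> * d \<le> \<theta>"
    and \<iota>_def: "\<iota> = announce g a (\<delta> + 1) \<theta> i H c b col"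
    and col'_def: "col' = commit g a (\<delta> + 1) H c Out col \<iota>"
  shows "partial_coloring H (\<delta> + 1) col'" "extends col' col"
    "\<And>v. col' v = None \<Longrightarrow> b v = i \<Longrightarrow> 2 * card (uncolored H col v) < \<theta>"
proof -
  let ?M = "\<delta> + 1"
  have "0 < a" using M by (cases a) auto
  have \<iota>_None: "\<iota> v = None" if "col v \<noteq> None" for v
    using that by (simp add: \<iota>_def announce_def)
  have good: "x \<in> free_colors ?M H col v \<and> x \<in> graph_pts g a (c v) s \<and>
      (\<forall>u\<in>Out v. \<forall>s'. \<iota> u = Some s' \<longrightarrow> x \<notin> graph_pts g a (c u) s')"
    if s: "\<iota> v = Some s" and x: "col' v = Some x" for v s x
  proof -
    let ?A = "free_colors ?M H col v" and ?O = "{u \<in> Out v. \<iota> u \<noteq> None}"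
    have act: "\<theta> \<le> 2 * card (uncolored H col v)"
      and s_eq: "s = (SOME s. s < 2 * a \<and> card ?A \<le> 2 * a * card (?A \<inter> graph_pts g a (c v) s))"
      using s unfolding \<iota>_def announce_def by (auto split: if_splits)
    have "?A \<subseteq> {..<2 * a * a}" using M by (auto simp: free_colors_def)
    from graph_pts_shift_exists[of g a ?A, OF spread_less[OF sp] this \<open>0 < a\<close>]
    have "\<exists>s. s < 2 * a \<and> card ?A \<le> 2 * a * card (?A \<inter> graph_pts g a (c v) s)" by blast
    then have s_prop: "s < 2 * a" "card ?A \<le> 2 * a * card (?A \<inter> graph_pts g a (c v) s)"
      unfolding s_eq by (rule someI2_ex; simp)+
    have "card ?O \<le> card (Out v)"
      using finite_subset[OF Out_sub] gr by (intro card_mono) (auto simp: nbr_graph_def)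
    then have "card ?O * d \<le> \<beta> * d" using Out_card[of v] by (intro mult_right_mono) simp_all
    moreover have "\<beta> * d < card (?A \<inter> graph_pts g a (c v) s)"
    proof (rule ccontr)
      assume "\<not> ?thesis"
      then have "2 * a * card (?A \<inter> graph_pts g a (c v) s) \<le> 2 * a * (\<beta> * d)" by simp
      then have "card ?A \<le> 2 * a * (\<beta> * d)" using s_prop(2) by (rule order_trans[rotated])
      moreover have "2 * (2 * a * (\<beta> * d)) = 4 * a * \<beta> * d" by simp
      ultimately have "2 * card ?A \<le> \<theta>" using \<beta> by linarith
      then show False using act card_free_colors_gt_uncolored[OF gr, of col v] by linarith
    qed
    ultimately have big: "card ?O * d < card (?A \<inter> graph_pts g a (c v) s)" by linarith
    have "\<exists>x\<in>?A \<inter> graph_pts g a (c v) s. \<forall>u\<in>?O. x \<notin> graph_pts g a (c u) (the (\<iota> u))"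
    proof (rule exists_avoiding_small_overlaps[OF _ _ _ big])
      fix u assume "u \<in> ?O"
      then have "u \<in> H v" using Out_sub by blast
      then have "c v < m" "c u < m" "c v \<noteq> c u" using c by (auto simp: colors_def)
      then have "card (graph_pts g a (c v) s \<inter> graph_pts g a (c u) (the (\<iota> u))) \<le> d"
        by (intro order_trans[OF card_graph_pts_Int_le[where f = g, OF spread_less[OF sp] s_prop(1)]] spread_agree[OF sp])
      moreover have "card (?A \<inter> graph_pts g a (c v) s \<inter> graph_pts g a (c u) (the (\<iota> u))) \<le>
        card (graph_pts g a (c v) s \<inter> graph_pts g a (c u) (the (\<iota> u)))"
        by (intro card_mono) auto
      ultimately show "card (?A \<inter> graph_pts g a (c v) s \<inter> graph_pts g a (c u) (the (\<iota> u))) \<le> d" by linarith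
    next
      show "finite ?O" using finite_subset[OF Out_sub, of v] gr by (simp add: nbr_graph_def)
    qed simp
    then have ex: "\<exists>x. x \<in> ?A \<inter> graph_pts g a (c v) s \<and> (\<forall>u\<in>?O. x \<notin> graph_pts g a (c u) (the (\<iota> u)))" by blast
    have "x = (SOME x. x \<in> ?A \<inter> graph_pts g a (c v) s \<and> (\<forall>u\<in>?O. x \<notin> graph_pts g a (c u) (the (\<iota> u))))"
      using x s by (simp add: col'_def commit_def)
    with someI_ex[OF ex] have "x \<in> ?A \<inter> graph_pts g a (c v) s \<and> (\<forall>u\<in>?O. x \<notin> graph_pts g a (c u) (the (\<iota> u)))" by simp
    then show ?thesis by fastforce
  qed
  have old: "col' v = col v" if "\<iota> v = None" for v using that by (simp add: col'_def commit_def)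
  have new: "\<exists>x. col' v = Some x" if "\<iota> v = Some s" for v s using that by (simp add: col'_def commit_def)
  show "extends col' col" unfolding extends_def using old \<iota>_None by (metis option.distinct(1))
  show "2 * card (uncolored H col v) < \<theta>" if "col' v = None" "b v = i" for v
  proof -
    have "\<iota> v = None" using new[of v] that by (cases "\<iota> v") auto
    moreover then have "col v = None" using old that by simp
    ultimately show ?thesis using that unfolding \<iota>_def announce_def by (auto split: if_splits)
  qed
  have clash: False
    if uv: "u \<in> H v" "u \<in> Out v \<or> v \<in> Out u" "\<iota> v = Some s" "\<iota> u = Some s'" "col' v = Some x" "col' u = Some x"
    for u v s s' x
    using good[OF uv(3,5)] good[OF uv(4,6)] uv by blast
  have in_class: "col v = None \<and> b v = i" if "\<iota> v = Some s" for v s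
    using that unfolding \<iota>_def announce_def by (auto split: if_splits)
  show "partial_coloring H ?M col'"
    unfolding partial_coloring_def
  proof (intro allI impI conjI ballI notI)
    fix v x assume x: "col' v = Some x"
    show "x < ?M"
    proof (cases "\<iota> v")
      case None
      then show ?thesis using x old col by (auto simp: partial_coloring_def)
    next
      case (Some s)
      then show ?thesis using good[OF Some x] by (simp add: free_colors_def)
    qed
    fix u assume u: "u \<in> H v" "col' u = Some x"
    have vu: "v \<in> H u" using gr u by (auto simp: nbr_graph_def)
    show False
    proof (cases "\<iota> v"; cases "\<iota> u")
      assume "\<iota> v = None" "\<iota> u = None"
      then show False using old x u col by (metis partial_coloring_def)
    next
      fix s assume "\<iota> v = None" "\<iota> u = Some s"
      then show False using good[of u s x] u vu old[of v] x by (auto simp: free_colors_def)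
    next
      fix s assume "\<iota> v = Some s" "\<iota> u = None"
      then show False using good[of v s x] u vu old[of u] x by (auto simp: free_colors_def)
    next
      fix s s' assume *: "\<iota> v = Some s" "\<iota> u = Some s'"
      then have "u \<in> Out v \<or> v \<in> Out u" using in_class[OF *(1)] in_class[OF *(2)] u(1) by (intro Out_total) auto
      then show False using clash[OF u(1) _ * x u(2)] by blast
    qed
  qed
qed

text \<open>One class after another, two rounds each. A vertex passed over in its turn is below the
  threshold, and stays below it because colours are never revoked.\<close>

lemma class_steps:
  assumes H: "loc r H" "sub_nbrs H" and c: "loc r c" and b: "loc r b" and Out: "loc r Out" "sub_nbrs Out"
    and col: "loc r col" and sp: "spread g m a d" and M: "\<delta> + 1 \<le> 2 * a * a"
    and \<beta>: "4 * a * \<beta> * d \<le> \<theta>"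
  shows "\<exists>col'. loc (r + 2 * i) col' \<and> (\<forall>E. colors (H E) m (c E) \<longrightarrow> nbr_graph (H E) \<delta> \<longrightarrow>
    partial_coloring (H E) (\<delta> + 1) (col E) \<longrightarrow> (\<forall>v. Out E v \<subseteq> H E v \<and> card (Out E v) \<le> \<beta>) \<longrightarrow>
    (\<forall>v. \<forall>u\<in>H E v. col E u = None \<longrightarrow> col E v = None \<longrightarrow> b E u = b E v \<longrightarrow> u \<in> Out E v \<or> v \<in> Out E u) \<longrightarrow>
    partial_coloring (H E) (\<delta> + 1) (col' E) \<and> extends (col' E) (col E) \<and>
    (\<forall>v. col' E v = None \<longrightarrow> b E v < i \<longrightarrow> 2 * card (uncolored (H E) (col' E) v) < \<theta>))"
proof (induction i)
  case 0
  show ?case by (rule exI[of _ col]) (simp add: col extends_def)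
next
  case (Suc i)
  then obtain col1 where L: "loc (r + 2 * i) col1" and
    IH: "\<And>E. colors (H E) m (c E) \<Longrightarrow> nbr_graph (H E) \<delta> \<Longrightarrow>
    partial_coloring (H E) (\<delta> + 1) (col E) \<Longrightarrow> (\<forall>v. Out E v \<subseteq> H E v \<and> card (Out E v) \<le> \<beta>) \<Longrightarrow>
    (\<forall>v. \<forall>u\<in>H E v. col E u = None \<longrightarrow> col E v = None \<longrightarrow> b E u = b E v \<longrightarrow> u \<in> Out E v \<or> v \<in> Out E u) \<Longrightarrow>
    partial_coloring (H E) (\<delta> + 1) (col1 E) \<and> extends (col1 E) (col E) \<and>
    (\<forall>v. col1 E v = None \<longrightarrow> b E v < i \<longrightarrow> 2 * card (uncolored (H E) (col1 E) v) < \<theta>)"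
    by blast
  define \<iota> where "\<iota> E = announce g a (\<delta> + 1) \<theta> i (H E) (c E) (b E) (col1 E)" for E
  define col2 where "col2 E = commit g a (\<delta> + 1) (H E) (c E) (Out E) (col1 E) (\<iota> E)" for E
  have "loc (Suc (r + 2 * i)) \<iota>"
    unfolding \<iota>_def using H c b L by (intro loc_announce) (auto intro: loc_mono)
  then have "loc (Suc (Suc (r + 2 * i))) col2"
    unfolding col2_def using H c b L Out by (intro loc_commit) (auto intro: loc_mono)
  then have "loc (r + 2 * Suc i) col2" by simp
  moreover have "partial_coloring (H E) (\<delta> + 1) (col2 E) \<and> extends (col2 E) (col E) \<and>
    (\<forall>v. col2 E v = None \<longrightarrow> b E v < Suc i \<longrightarrow> 2 * card (uncolored (H E) (col2 E) v) < \<theta>)"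
    if A: "colors (H E) m (c E)" "nbr_graph (H E) \<delta>" "partial_coloring (H E) (\<delta> + 1) (col E)"
      "\<forall>v. Out E v \<subseteq> H E v \<and> card (Out E v) \<le> \<beta>"
      "\<forall>v. \<forall>u\<in>H E v. col E u = None \<longrightarrow> col E v = None \<longrightarrow> b E u = b E v \<longrightarrow> u \<in> Out E v \<or> v \<in> Out E u"
    for E
  proof -
    have I: "partial_coloring (H E) (\<delta> + 1) (col1 E)" "extends (col1 E) (col E)"
      "\<And>v. col1 E v = None \<Longrightarrow> b E v < i \<Longrightarrow> 2 * card (uncolored (H E) (col1 E) v) < \<theta>"
      using IH[OF A] by auto
    have total: "u \<in> Out E v \<or> v \<in> Out E u"
      if "u \<in> H E v" "col1 E u = None" "col1 E v = None" "b E u = b E v" for u v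
      using A(5) that extends_None[OF I(2)] by blast
    have C: "partial_coloring (H E) (\<delta> + 1) (col2 E)" "extends (col2 E) (col1 E)"
      "\<And>v. col2 E v = None \<Longrightarrow> b E v = i \<Longrightarrow> 2 * card (uncolored (H E) (col1 E) v) < \<theta>"
      using commit_correct[OF sp A(1,2) M I(1) _ _ total \<beta> \<iota>_def col2_def] A(4) by blast+
    have "2 * card (uncolored (H E) (col2 E) v) < \<theta>" if "col2 E v = None" "b E v < Suc i" for v
    proof -
      have "2 * card (uncolored (H E) (col1 E) v) < \<theta>"
        using that C(3)[of v] I(3)[of v] extends_None[OF C(2)] by (auto simp: less_Suc_eq)
      moreover have "card (uncolored (H E) (col2 E) v) \<le> card (uncolored (H E) (col1 E) v)"
        using A(2) by (intro card_uncolored_extends C(2)) (simp add: nbr_graph_def)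
      ultimately show ?thesis by linarith
    qed
    moreover have "extends (col2 E) (col E)" using C(2) I(2) by (auto simp: extends_def)
    ultimately show ?thesis using C(1) by blast
  qed
  ultimately show ?case by blast
qed

text \<open>The bounds \<open>4 * a * \<beta> * d \<le> \<theta>\<close> (colour choice succeeds) and \<open>2 * d * \<theta> < a' * (\<beta> + 1)\<close>
  (partition exists) are compatible because \<open>a'\<close> is at least \<open>8 * d\<^sup>2 * a\<close>; note that \<open>\<theta>\<close> cancels.\<close>
lemma coloring_phase:
  assumes H: "loc r H" "sub_nbrs H" and c: "loc r c" and col: "loc r col"
    and sp: "spread g m a d" and sp': "spread f m a' d" and M: "\<delta> + 1 \<le> 2 * a * a"
    and d: "0 < d" and a': "8 * d * d * a \<le> a'"
  shows "\<exists>col'. loc (r + (5 * a' + 2)) col' \<and> (\<forall>E. colors (H E) m (c E) \<longrightarrow> nbr_graph (H E) \<delta> \<longrightarrow>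
    partial_coloring (H E) (\<delta> + 1) (col E) \<longrightarrow> (\<forall>v. col E v = None \<longrightarrow> card (uncolored (H E) (col E) v) \<le> \<theta>) \<longrightarrow>
    partial_coloring (H E) (\<delta> + 1) (col' E) \<and> (\<forall>v. col' E v = None \<longrightarrow> 2 * card (uncolored (H E) (col' E) v) < \<theta>))"
proof -
  have a: "0 < a" using M by (cases a) auto
  \<comment> \<open>The largest out-degree that the colour choice tolerates.\<close>
  define \<beta> where "\<beta> = \<theta> div (4 * a * d)"
  have "\<beta> * (4 * a * d) \<le> \<theta>" unfolding \<beta>_def by (rule div_times_less_eq_dividend)
  then have \<beta>: "4 * a * \<beta> * d \<le> \<theta>" by (simp add: mult_ac)
  have "\<theta> < (\<beta> + 1) * (4 * a * d)"
    unfolding \<beta>_def add_mult_distrib using dividend_less_div_times[of "4 * a * d" \<theta>] a d by simp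
  then have "2 * d * \<theta> < 2 * d * ((\<beta> + 1) * (4 * a * d))" using d by simp
  also have "\<dots> = 8 * d * d * a * (\<beta> + 1)" by (simp add: algebra_simps)
  also have "\<dots> \<le> a' * (\<beta> + 1)" using a' by (rule mult_right_mono) simp
  finally have ab: "2 * d * \<theta> < a' * (\<beta> + 1)" .
  \<comment> \<open>Coloured vertices get no neighbours: the degree bound \<theta> is assumed for
    uncoloured ones only.\<close>
  define U where "U E v = (if col E v = None then uncolored (H E) (col E) v else {})" for E v
  define \<tau> where "\<tau> E v = the (settle f \<beta> (U E) (c E) a' v)" for E v
  define b where "b E v = f (c E v) (\<tau> E v)" for E v
  define Out where "Out E v = {u \<in> U E v. \<tau> E u \<le> \<tau> E v \<and> b E u = b E v}" for E v
  have subU: "sub_nbrs U" using H(2) by (auto simp: sub_nbrs_def U_def uncolored_def)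
  have subOut: "sub_nbrs Out" using subU by (auto simp: sub_nbrs_def Out_def)
  have U: "loc (r + 1) U"
  proof (rule locI)
    fix E E' v assume ag: "agree (r + 1) E E' v"
    have "H E v = H E' v" "col E v = col E' v" using locD[OF H(1) ag] locD[OF col ag] by auto
    moreover have "col E w = col E' w" if "w \<in> H E v" for w
      using locD_sub[OF col H(2) ag _ that] by simp
    ultimately show "U E v = U E' v" by (auto simp: U_def uncolored_def)
  qed
  have \<tau>: "loc (r + 1 + a') \<tau>"
    unfolding \<tau>_def by (rule loc_comp[where h = the], rule loc_settle[OF U subU loc_mono[OF c]]) simp
  have b: "loc (r + 1 + a') b"
    unfolding b_def by (rule loc_comp2[where h = f, OF loc_mono[OF c] \<tau>]) simp
  have Out: "loc (r + 2 + a') Out"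
  proof (rule locI)
    fix E E' v assume ag: "agree (r + 2 + a') E E' v"
    have "U E v = U E' v" "\<tau> E v = \<tau> E' v" "b E v = b E' v"
      using locD[OF U ag] locD[OF \<tau> ag] locD[OF b ag] by auto
    moreover have "\<tau> E w = \<tau> E' w" "b E w = b E' w" if "w \<in> U E v" for w
      using locD_sub[OF \<tau> subU ag _ that] locD_sub[OF b subU ag _ that] by auto
    ultimately show "Out E v = Out E' v" by (auto simp: Out_def)
  qed
  \<comment> \<open>Values of \<open>f\<close> are below 2 * a', so there are 2 * a' classes at two
    rounds each; with a' settling rounds and two more for \<open>U\<close> and \<open>Out\<close>
    this makes 5 * a' + 2.\<close>
  obtain col' where L: "loc (r + 2 + a' + 2 * (2 * a')) col'" and
    S: "\<And>E. colors (H E) m (c E) \<Longrightarrow> nbr_graph (H E) \<delta> \<Longrightarrow>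
    partial_coloring (H E) (\<delta> + 1) (col E) \<Longrightarrow> (\<forall>v. Out E v \<subseteq> H E v \<and> card (Out E v) \<le> \<beta>) \<Longrightarrow>
    (\<forall>v. \<forall>u\<in>H E v. col E u = None \<longrightarrow> col E v = None \<longrightarrow> b E u = b E v \<longrightarrow> u \<in> Out E v \<or> v \<in> Out E u) \<Longrightarrow>
    partial_coloring (H E) (\<delta> + 1) (col' E) \<and> extends (col' E) (col E) \<and>
    (\<forall>v. col' E v = None \<longrightarrow> b E v < 2 * a' \<longrightarrow> 2 * card (uncolored (H E) (col' E) v) < \<theta>)"
    using class_steps[OF loc_mono[OF H(1)] H(2) loc_mono[OF c] loc_mono[OF b] Out subOut loc_mono[OF col] sp M \<beta>,
        of "2 * a'"] by auto
  have "partial_coloring (H E) (\<delta> + 1) (col' E) \<and> (\<forall>v. col' E v = None \<longrightarrow> 2 * card (uncolored (H E) (col' E) v) < \<theta>)"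
    if A: "colors (H E) m (c E)" "nbr_graph (H E) \<delta>" "partial_coloring (H E) (\<delta> + 1) (col E)"
      and uncolored: "\<forall>v. col E v = None \<longrightarrow> card (uncolored (H E) (col E) v) \<le> \<theta>" for E
  proof -
    have gU: "nbr_graph (U E) \<theta>"
      using A(2) uncolored unfolding nbr_graph_def U_def by (auto simp: uncolored_def)
    have cU: "colors (U E) m (c E)"
      using A(1) unfolding colors_def U_def by (auto simp: uncolored_def split: if_splits)
    have fin: "\<exists>s<a'. settle f \<beta> (U E) (c E) a' v = Some s" for v by (rule settle_terminates[OF sp' cU gU ab])
    have "card (Out E v) \<le> \<beta>" for v
      using settle_outdegree[OF fin gU, of "\<tau> E" v] by (simp add: Out_def b_def \<tau>_def)
    moreover have "Out E v \<subseteq> H E v" for v by (auto simp: Out_def U_def uncolored_def)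
    moreover have "u \<in> Out E v \<or> v \<in> Out E u"
      if "u \<in> H E v" "col E u = None" "col E v = None" "b E u = b E v" for u v
    proof -
      have "v \<in> H E u" using A(2) that by (auto simp: nbr_graph_def)
      then show ?thesis using that linear[of "\<tau> E u" "\<tau> E v"] by (auto simp: Out_def U_def uncolored_def)
    qed
    moreover have "b E v < 2 * a'" for v unfolding b_def by (rule spread_less[OF sp'])
    ultimately show ?thesis using S[OF A] by blast
  qed
  moreover have "loc (r + (5 * a' + 2)) col'" using L by (rule loc_mono) simp
  ultimately show ?thesis by blast
qed

lemma coloring_phases:
  assumes H: "loc r H" "sub_nbrs H" and c: "loc r c"
    and sp: "spread g m a d" and sp': "spread f m a' d" and M: "\<delta> + 1 \<le> 2 * a * a"
    and d: "0 < d" and a': "8 * d * d * a \<le> a'"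
  shows "\<exists>col. loc (r + j * (5 * a' + 2)) col \<and> (\<forall>E. colors (H E) m (c E) \<longrightarrow> nbr_graph (H E) \<delta> \<longrightarrow>
    partial_coloring (H E) (\<delta> + 1) (col E) \<and> (\<forall>v. col E v = None \<longrightarrow> card (uncolored (H E) (col E) v) \<le> \<delta> div 2 ^ j))"
proof (induction j)
  case 0
  have "card (uncolored (H E) (\<lambda>_. None) v) \<le> \<delta>" if "nbr_graph (H E) \<delta>" for E v
    using that by (simp add: nbr_graph_def uncolored_def)
  then show ?case by (intro exI[of _ "\<lambda>E v. None"]) (simp add: loc_def partial_coloring_def)
next
  case (Suc j)
  then obtain col where L: "loc (r + j * (5 * a' + 2)) col" and
    IH: "\<And>E. colors (H E) m (c E) \<Longrightarrow> nbr_graph (H E) \<delta> \<Longrightarrow>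
    partial_coloring (H E) (\<delta> + 1) (col E) \<and> (\<forall>v. col E v = None \<longrightarrow> card (uncolored (H E) (col E) v) \<le> \<delta> div 2 ^ j)" by blast
  obtain col' where L': "loc (r + j * (5 * a' + 2) + (5 * a' + 2)) col'" and
    C: "\<And>E. colors (H E) m (c E) \<Longrightarrow> nbr_graph (H E) \<delta> \<Longrightarrow>
    partial_coloring (H E) (\<delta> + 1) (col E) \<Longrightarrow> (\<forall>v. col E v = None \<longrightarrow> card (uncolored (H E) (col E) v) \<le> \<delta> div 2 ^ j) \<Longrightarrow>
    partial_coloring (H E) (\<delta> + 1) (col' E) \<and> (\<forall>v. col' E v = None \<longrightarrow> 2 * card (uncolored (H E) (col' E) v) < \<delta> div 2 ^ j)"
    using coloring_phase[OF loc_mono[OF H(1)] H(2) loc_mono[OF c] L sp sp' M d a', of "\<delta> div 2 ^ j"] by auto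
  have half: "k \<le> \<delta> div 2 ^ Suc j" if "2 * k < \<delta> div 2 ^ j" for k
  proof -
    have "k \<le> (\<delta> div 2 ^ j) div 2" using that by linarith
    also have "\<dots> = \<delta> div 2 ^ Suc j" by (simp only: div_mult2_eq[symmetric] power_Suc mult.commute)
    finally show ?thesis .
  qed
  have "partial_coloring (H E) (\<delta> + 1) (col' E) \<and> (\<forall>v. col' E v = None \<longrightarrow> card (uncolored (H E) (col' E) v) \<le> \<delta> div 2 ^ Suc j)"
    if "colors (H E) m (c E)" "nbr_graph (H E) \<delta>" for E
    using C[OF that] IH[OF that] half by blast
  moreover have "loc (r + Suc j * (5 * a' + 2)) col'" using L' by (rule loc_mono) simp
  ultimately show ?case by blast
qed

text \<open>After j halvings no uncoloured vertex has an uncoloured neighbour. One more phase with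
  threshold 0 lets every vertex take part, and a vertex left over would have to satisfy an
  inequality below 0.\<close>

lemma degree_plus_one_coloring:
  assumes H: "loc r H" "sub_nbrs H" and c: "loc r c"
    and sp: "spread g m a d" and sp': "spread f m a' d" and M: "\<delta> + 1 \<le> 2 * a * a"
    and d: "0 < d" and a': "8 * d * d * a \<le> a'" and j: "\<delta> < 2 ^ j"
  shows "\<exists>\<phi>. loc (r + (j + 1) * (5 * a' + 2)) \<phi> \<and>
    (\<forall>E. colors (H E) m (c E) \<longrightarrow> nbr_graph (H E) \<delta> \<longrightarrow> colors (H E) (\<delta> + 1) (\<phi> E))"
proof -
  obtain col where L: "loc (r + j * (5 * a' + 2)) col" and
    I: "\<And>E. colors (H E) m (c E) \<Longrightarrow> nbr_graph (H E) \<delta> \<Longrightarrow>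
    partial_coloring (H E) (\<delta> + 1) (col E) \<and> (\<forall>v. col E v = None \<longrightarrow> card (uncolored (H E) (col E) v) \<le> \<delta> div 2 ^ j)"
    using coloring_phases[OF H c sp sp' M d a', of j] by blast
  obtain col' where L': "loc (r + j * (5 * a' + 2) + (5 * a' + 2)) col'" and
    C: "\<And>E. colors (H E) m (c E) \<Longrightarrow> nbr_graph (H E) \<delta> \<Longrightarrow>
    partial_coloring (H E) (\<delta> + 1) (col E) \<Longrightarrow> (\<forall>v. col E v = None \<longrightarrow> card (uncolored (H E) (col E) v) \<le> 0) \<Longrightarrow>
    partial_coloring (H E) (\<delta> + 1) (col' E) \<and> (\<forall>v. col' E v = None \<longrightarrow> 2 * card (uncolored (H E) (col' E) v) < 0)"
    using coloring_phase[OF loc_mono[OF H(1)] H(2) loc_mono[OF c] L sp sp' M d a', of 0] by auto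
  have "loc (r + (j + 1) * (5 * a' + 2)) (\<lambda>E v. the (col' E v))"
    by (rule loc_comp[OF loc_mono[OF L']]) simp
  moreover have "colors (H E) (\<delta> + 1) (\<lambda>v. the (col' E v))"
    if "colors (H E) m (c E)" "nbr_graph (H E) \<delta>" for E
  proof -
    have "\<forall>v. col E v = None \<longrightarrow> card (uncolored (H E) (col E) v) \<le> 0" using I[OF that] j by simp
    with C[OF that] I[OF that] have P: "partial_coloring (H E) (\<delta> + 1) (col' E)" "\<And>v. col' E v \<noteq> None" by auto
    then show ?thesis unfolding partial_coloring_def colors_def by (metis option.collapse)
  qed
  ultimately show ?thesis by blast
qed

section \<open>Connectors of maximal cliques\<close>

text \<open>Hides the colouring algorithm from the recursion over levels, which needs only its round
  count R, the same for every derived graph and starting radius.\<close>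

definition colorable_in :: "nat \<Rightarrow> nat \<Rightarrow> nat \<Rightarrow> bool" where
  "colorable_in m \<delta> R \<longleftrightarrow> (\<forall>r H c. loc r H \<longrightarrow> sub_nbrs H \<longrightarrow> loc r c \<longrightarrow> (\<exists>\<phi>. loc (r + R) \<phi> \<and>
    (\<forall>E. colors (H E) m (c E) \<longrightarrow> nbr_graph (H E) \<delta> \<longrightarrow> colors (H E) (\<delta> + 1) (\<phi> E))))"

text \<open>Stated without a vertex set, as locality demands. The empty set is excluded, and a
  number outside the network forms a maximal clique by itself.\<close>

definition maximal_clique :: "(nat \<Rightarrow> nat \<Rightarrow> bool) \<Rightarrow> nat set \<Rightarrow> bool" where
  "maximal_clique E K \<longleftrightarrow> (\<forall>a\<in>K. \<forall>b\<in>K. a \<noteq> b \<longrightarrow> E a b) \<and> (\<forall>x. x \<notin> K \<longrightarrow> (\<exists>a\<in>K. \<not> E a x))"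

definition cliques_at :: "(nat \<Rightarrow> nat \<Rightarrow> bool) \<Rightarrow> nat \<Rightarrow> nat set set" where
  "cliques_at E v = {K. maximal_clique E K \<and> v \<in> K}"

text \<open>Members of a clique through v are v or its neighbours, so their adjacency rows are known
  after two rounds, and these rows decide maximality.\<close>

lemma loc_cliques_at: "loc 2 cliques_at"
proof (rule locI)
  fix E E' :: "nat \<Rightarrow> nat \<Rightarrow> bool" and v assume ag: "agree 2 E E' v"
  have v: "E v = E' v" and w: "\<And>w. E v w \<Longrightarrow> E w = E' w"
    using ag by (auto simp: numeral_2_eq_2)
  have row: "E a = E' a" if "v \<in> K" "a \<in> K" "maximal_clique E K \<or> maximal_clique E' K" for K a
    using that v w by (cases "a = v") (auto simp: maximal_clique_def)
  have "maximal_clique E K \<longleftrightarrow> maximal_clique E' K" if "v \<in> K" for K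
  proof
    assume "maximal_clique E K"
    then show "maximal_clique E' K" using row[OF that] unfolding maximal_clique_def by metis
  next
    assume "maximal_clique E' K"
    then show "maximal_clique E K" using row[OF that] unfolding maximal_clique_def by metis
  qed
  then show "cliques_at E v = cliques_at E' v" unfolding cliques_at_def by auto
qed

definition rank_in :: "nat set \<Rightarrow> nat \<Rightarrow> nat" where
  "rank_in A w = card {u \<in> A. u < w}"

lemma rank_in_less: "finite A \<Longrightarrow> w \<in> A \<Longrightarrow> rank_in A w < card A"
  unfolding rank_in_def by (rule psubset_card_mono) auto

lemma rank_in_strict_mono: "finite A \<Longrightarrow> u \<in> A \<Longrightarrow> u < w \<Longrightarrow> rank_in A u < rank_in A w"
  unfolding rank_in_def by (rule psubset_card_mono) auto

lemma inj_on_rank_in: "finite A \<Longrightarrow> inj_on (rank_in A) A"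
  by (rule linorder_inj_onI') (metis less_irrefl rank_in_strict_mono)

lemma card_block_le:
  assumes "finite A" "0 < t"
  shows "card {u \<in> A. rank_in A u div t = q} \<le> t"
proof -
  have "rank_in A ` {u \<in> A. rank_in A u div t = q} \<subseteq> {q * t..<q * t + t}"
  proof
    fix y assume "y \<in> rank_in A ` {u \<in> A. rank_in A u div t = q}"
    then have "y div t = q" by auto
    then have "y = q * t + y mod t" using div_mult_mod_eq[of y t] by simp
    moreover have "y mod t < t" using assms(2) by simp
    ultimately show "y \<in> {q * t..<q * t + t}" by simp
  qed
  moreover have "inj_on (rank_in A) {u \<in> A. rank_in A u div t = q}"
    by (rule inj_on_subset[OF inj_on_rank_in[OF assms(1)]]) auto
  ultimately have "card {u \<in> A. rank_in A u div t = q} \<le> card {q * t..<q * t + t}"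
    by (intro card_inj_on_le) auto
  then show ?thesis by simp
qed

text \<open>Distinct block indices force one index of at least card B - 1, hence a rank of at least
  t times that; ranks end at card A - 1. Counting size minus one lets the factors of successive
  levels multiply exactly.\<close>

lemma card_distinct_blocks:
  assumes "finite A" "B \<subseteq> A" "inj_on (\<lambda>u. rank_in A u div t) B"
  shows "t * (card B - 1) \<le> card A - 1"
proof (cases "B = {}")
  case False
  have "finite B" using assms finite_subset by blast
  have "\<exists>u\<in>B. card B - 1 \<le> rank_in A u div t"
  proof (rule ccontr)
    assume "\<not> ?thesis"
    then have "(\<lambda>u. rank_in A u div t) ` B \<subseteq> {..<card B - 1}" by auto
    from card_inj_on_le[OF assms(3) this] have "card B \<le> card B - 1" by simp
    moreover have "0 < card B" using False \<open>finite B\<close> by (simp add: card_gt_0_iff)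
    ultimately show False by linarith
  qed
  then obtain u where u: "u \<in> B" "card B - 1 \<le> rank_in A u div t" by blast
  have "t * (card B - 1) \<le> t * (rank_in A u div t)" using u(2) by (rule mult_left_mono) simp
  also have "\<dots> \<le> rank_in A u" by simp
  also have "\<dots> \<le> card A - 1" using rank_in_less[OF assms(1), of u] u(1) assms(2) by auto
  finally show ?thesis .
qed simp

text \<open>Ranks are taken inside the current monochromatic part of each clique, so the blocks are
  renewed at every level.\<close>

definition connector :: "nat \<Rightarrow> (nat \<Rightarrow> nat \<Rightarrow> bool) \<Rightarrow> (nat \<Rightarrow> nat) \<Rightarrow> nat \<Rightarrow> nat set" where
  "connector t E \<psi> v = {w. w \<noteq> v \<and> (\<exists>K\<in>cliques_at E v. w \<in> K \<and> \<psi> w = \<psi> v \<and>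
     rank_in {u \<in> K. \<psi> u = \<psi> v} w div t = rank_in {u \<in> K. \<psi> u = \<psi> v} v div t)}"

lemma connector_edge: "w \<in> connector t E \<psi> v \<Longrightarrow> E v w"
  by (auto simp: connector_def cliques_at_def maximal_clique_def)

lemma connector_sym:
  assumes "w \<in> connector t E \<psi> v"
  shows "v \<in> connector t E \<psi> w"
proof -
  obtain K where K: "maximal_clique E K" "v \<in> K" "w \<in> K" "w \<noteq> v" "\<psi> w = \<psi> v"
    "rank_in {u \<in> K. \<psi> u = \<psi> v} w div t = rank_in {u \<in> K. \<psi> u = \<psi> v} v div t"
    using assms unfolding connector_def cliques_at_def by blast
  then show ?thesis unfolding connector_def cliques_at_def by (auto intro!: exI[of _ K])
qed

lemma loc_connector:
  assumes \<psi>: "loc r \<psi>" and "2 \<le> r"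
  shows "loc (Suc r) (\<lambda>E. connector t E (\<psi> E))"
proof (rule locI)
  fix E E' v assume ag: "agree (Suc r) E E' v"
  have cl: "cliques_at E v = cliques_at E' v" using locD[OF loc_cliques_at ag] assms by simp
  have "\<psi> E u = \<psi> E' u" if "K \<in> cliques_at E v" "u \<in> K" for K u
  proof (cases "u = v")
    case True
    then show ?thesis using locD[OF \<psi> ag] by simp
  next
    case False
    then have "E v u" using that by (auto simp: cliques_at_def maximal_clique_def)
    then show ?thesis using locD_nbr[OF \<psi> ag] by simp
  qed
  then have "\<psi> E v = \<psi> E' v" "{u \<in> K. \<psi> E u = \<psi> E v} = {u \<in> K. \<psi> E' u = \<psi> E' v}"
    "\<And>w. w \<in> K \<Longrightarrow> \<psi> E w = \<psi> E' w"
    if "K \<in> cliques_at E v" for K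
    using that by (auto simp: cliques_at_def)
  then show "connector t E (\<psi> E) v = connector t E' (\<psi> E') v"
    unfolding connector_def using cl by (intro Collect_cong conj_cong bex_cong refl) simp_all
qed

section \<open>Cliques without a vertex set against diversity, clique size and degree\<close>

lemma simple_graph_finite: "simple_graph V E \<Longrightarrow> finite V"
  and simple_graph_edge: "simple_graph V E \<Longrightarrow> E u w \<Longrightarrow> u \<in> V \<and> w \<in> V \<and> u \<noteq> w \<and> E w u"
  unfolding simple_graph_def by blast+

lemma finite_cliques:
  assumes "simple_graph V E"
  shows "finite {K. is_clique V E K}"
proof (rule finite_subset)
  show "{K. is_clique V E K} \<subseteq> Pow V" unfolding is_clique_def by blast
qed (use simple_graph_finite[OF assms] in simp)

lemma card_clique_le: "simple_graph V E \<Longrightarrow> is_clique V E K \<Longrightarrow> card K \<le> max_clique_size V E"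
  unfolding max_clique_size_def by (intro Max_ge finite_imageI finite_cliques) simp_all

lemma finite_maximal_clique:
  assumes "simple_graph V E" "maximal_clique E K"
  shows "finite K"
proof (cases "K = {}")
  case False
  then obtain a where "a \<in> K" by blast
  \<comment> \<open>All other members are neighbours of a and thus in V; a itself may lie
    outside.\<close>
  then have "K \<subseteq> insert a V" using assms by (auto simp: maximal_clique_def simple_graph_def)
  then show ?thesis using assms(1) finite_subset by (auto simp: simple_graph_def)
qed simp

lemma cliques_at_subset:
  assumes "simple_graph V E" "v \<in> V"
  shows "cliques_at E v \<subseteq> {K. is_maximal_clique V E K \<and> v \<in> K}"
proof
  fix K assume "K \<in> cliques_at E v"
  then have K: "maximal_clique E K" "v \<in> K" by (auto simp: cliques_at_def)
  then have "K \<subseteq> V" using assms by (metis maximal_clique_def simple_graph_def subsetI)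
  moreover have "K' = K" if cl: "is_clique V E K'" and sub: "K \<subseteq> K'" for K'
  proof (rule ccontr)
    assume "K' \<noteq> K"
    then obtain x where x: "x \<in> K'" "x \<notin> K" using sub by blast
    then obtain a where a: "a \<in> K" "\<not> E a x" using K by (auto simp: maximal_clique_def)
    then have "a \<noteq> x" "a \<in> K'" using x sub by blast+
    then show False using cl a x by (auto simp: is_clique_def)
  qed
  moreover have "is_clique V E K" using K(1) \<open>K \<subseteq> V\<close> by (simp add: is_clique_def maximal_clique_def)
  ultimately show "K \<in> {K. is_maximal_clique V E K \<and> v \<in> K}"
    using K(2) by (simp add: is_maximal_clique_def)
qed

lemma card_cliques_at:
  assumes "simple_graph V E" "v \<in> V"
  shows "finite (cliques_at E v) \<and> card (cliques_at E v) \<le> diversity V E"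
proof -
  have "K \<subseteq> V" if "is_maximal_clique V E K" for K
    using conjunct1[OF that[unfolded is_maximal_clique_def]] by (simp add: is_clique_def)
  then have "{K. is_maximal_clique V E K \<and> v \<in> K} \<subseteq> Pow V" by blast
  moreover have "finite (Pow V)" using assms by (simp add: simple_graph_def)
  ultimately have fin: "finite {K. is_maximal_clique V E K \<and> v \<in> K}" by (rule finite_subset)
  then have "card (cliques_at E v) \<le> vertex_diversity V E v"
    unfolding vertex_diversity_def by (rule card_mono[OF _ cliques_at_subset[OF assms]])
  also have "\<dots> \<le> diversity V E"
    unfolding diversity_def using assms by (intro Max_ge) (auto simp: simple_graph_def)
  finally show ?thesis using finite_subset[OF cliques_at_subset[OF assms] fin] by simp
qed

lemma nbrs_graph:
  assumes "simple_graph V E" "V \<noteq> {}"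
  shows "nbr_graph (\<lambda>v. {w. E v w}) (max_degree V E)"
proof -
  have sub: "{w. E v w} \<subseteq> V" and fin: "finite V" for v using assms by (auto simp: simple_graph_def)
  have "card {w. E v w} \<le> max_degree V E" for v
  proof (cases "v \<in> V")
    case True
    then show ?thesis unfolding max_degree_def using fin by (intro Max_ge) auto
  next
    case False
    then have "{w. E v w} = {}" using assms by (auto simp: simple_graph_def)
    then show ?thesis by (simp only: card.empty)
  qed
  then show ?thesis
    using finite_subset[OF sub fin] assms unfolding nbr_graph_def simple_graph_def by auto
qed

text \<open>The diversity can be exponential in the maximum degree; capping the degree bound by \<open>max_degree\<close> keeps
  the logarithmic factors polylogarithmic in the latter.\<close>
lemma connector_graph:
  assumes g: "simple_graph V E" "V \<noteq> {}" and t: "0 < t"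
    and \<delta>: "\<delta> = min (diversity V E * (t - 1)) (max_degree V E)"
  shows "nbr_graph (connector t E \<psi>) \<delta>"
proof -
  have fin: "finite {w. E v w}" and deg: "card {w. E v w} \<le> max_degree V E" for v
    using nbrs_graph[OF g] by (auto simp: nbr_graph_def)
  have sub: "connector t E \<psi> v \<subseteq> {w. E v w}" for v using connector_edge by blast
  have "card (connector t E \<psi> v) \<le> diversity V E * (t - 1)" for v
  proof (cases "v \<in> V")
    case False
    then have "{w. E v w} = {}" using g by (auto simp: simple_graph_def)
    then have "connector t E \<psi> v = {}" using sub[of v] by simp
    then show ?thesis by simp
  next
    case True
    let ?A = "\<lambda>K. {u \<in> K. \<psi> u = \<psi> v}"
    let ?B = "\<lambda>K. {u \<in> ?A K. rank_in (?A K) u div t = rank_in (?A K) v div t} - {v}"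
    note C = card_cliques_at[OF g(1) True]
    have finK: "finite K" if "K \<in> cliques_at E v" for K
      using that finite_maximal_clique[OF g(1)] by (simp add: cliques_at_def)
    have "connector t E \<psi> v \<subseteq> (\<Union>K\<in>cliques_at E v. ?B K)"
      unfolding connector_def by blast
    then have "card (connector t E \<psi> v) \<le> card (\<Union>K\<in>cliques_at E v. ?B K)"
      using C finK by (intro card_mono finite_UN_I) auto
    also have "\<dots> \<le> (\<Sum>K\<in>cliques_at E v. card (?B K))" using C by (intro card_UN_le) simp
    also have "\<dots> \<le> (\<Sum>K\<in>cliques_at E v. t - 1)"
    proof (rule sum_mono)
      fix K assume K: "K \<in> cliques_at E v"
      let ?X = "{u \<in> ?A K. rank_in (?A K) u div t = rank_in (?A K) v div t}"
      have "v \<in> ?X" using K by (simp add: cliques_at_def)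
      then have "card (?X - {v}) = card ?X - 1" by (rule card_Diff_singleton)
      moreover have "card ?X \<le> t" using finK[OF K] t by (intro card_block_le) simp_all
      ultimately show "card (?B K) \<le> t - 1" by linarith
    qed
    also have "\<dots> \<le> diversity V E * (t - 1)" using C by simp
    finally show ?thesis .
  qed
  moreover have "card (connector t E \<psi> v) \<le> max_degree V E" for v
    using card_mono[OF fin sub] deg le_trans by blast
  ultimately show ?thesis
    using finite_subset[OF sub fin] connector_sym unfolding nbr_graph_def \<delta> by auto
qed

text \<open>P is the product of the factors used so far. The new colour codes the old one together
  with the connector colour, so a monochromatic part of a clique lies in one old class and meets
  each block at most once. The extra round builds the connector.\<close>

lemma level_step:
  assumes \<psi>: "loc r \<psi>" and r: "2 \<le> r" and c: "loc r c" and t: "0 < t"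
    and \<delta>: "\<delta> = min (D * (t - 1)) \<Delta>" and R: "colorable_in m \<delta> R"
  shows "\<exists>\<psi>'. loc (r + (R + 1)) \<psi>' \<and> (\<forall>V E P S Q. simple_graph V E \<longrightarrow> V \<noteq> {} \<longrightarrow>
    diversity V E = D \<longrightarrow> max_degree V E = \<Delta> \<longrightarrow> colors (\<lambda>v. {w. E v w}) m (c E) \<longrightarrow>
    (\<forall>v. \<psi> E v < Q) \<longrightarrow> (\<forall>K y. maximal_clique E K \<longrightarrow> P * (card {w \<in> K. \<psi> E w = y} - 1) < S) \<longrightarrow>
    (\<forall>v. \<psi>' E v < Q * (\<delta> + 1)) \<and> (\<forall>K y. maximal_clique E K \<longrightarrow> P * t * (card {w \<in> K. \<psi>' E w = y} - 1) < S))"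
proof -
  have "sub_nbrs (\<lambda>E. connector t E (\<psi> E))" using connector_edge by (auto simp: sub_nbrs_def)
  from R[unfolded colorable_in_def, rule_format, OF loc_connector[OF \<psi> r] this loc_mono[OF c]]
  obtain \<phi> where L: "loc (Suc r + R) \<phi>" and
    \<phi>: "\<And>E. colors (connector t E (\<psi> E)) m (c E) \<Longrightarrow> nbr_graph (connector t E (\<psi> E)) \<delta> \<Longrightarrow>
      colors (connector t E (\<psi> E)) (\<delta> + 1) (\<phi> E)" by auto
  define \<psi>' where "\<psi>' E v = \<psi> E v * (\<delta> + 1) + \<phi> E v" for E v
  have "loc (r + (R + 1)) \<psi>'"
    unfolding \<psi>'_def
    by (rule loc_comp2[where h = "\<lambda>x y. x * (\<delta> + 1) + y", OF loc_mono[OF \<psi>] loc_mono[OF L]]) simp_all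
  moreover have "(\<forall>v. \<psi>' E v < Q * (\<delta> + 1)) \<and> (\<forall>K y. maximal_clique E K \<longrightarrow> P * t * (card {w \<in> K. \<psi>' E w = y} - 1) < S)"
    if g: "simple_graph V E" "V \<noteq> {}" "diversity V E = D" "max_degree V E = \<Delta>"
      and cE: "colors (\<lambda>v. {w. E v w}) m (c E)" and Q: "\<forall>v. \<psi> E v < Q"
      and P: "\<forall>K y. maximal_clique E K \<longrightarrow> P * (card {w \<in> K. \<psi> E w = y} - 1) < S"
    for V E P S Q
  proof -
    have "nbr_graph (connector t E (\<psi> E)) \<delta>"
      using g t \<delta> by (intro connector_graph[of V]) simp_all
    \<comment> \<open>The initial colouring is proper on every subgraph, so each level can start
      from it again.\<close>
    moreover have "colors (connector t E (\<psi> E)) m (c E)"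
      using cE connector_edge unfolding colors_def by blast
    ultimately have col: "colors (connector t E (\<psi> E)) (\<delta> + 1) (\<phi> E)" by (rule \<phi>[rotated])
    have lt: "\<phi> E v < \<delta> + 1" for v using col by (simp add: colors_def)
    have "\<psi>' E v < Q * (\<delta> + 1)" for v
    proof -
      have "\<psi>' E v < (\<psi> E v + 1) * (\<delta> + 1)" using lt[of v] by (simp add: \<psi>'_def)
      also have "\<dots> \<le> Q * (\<delta> + 1)" using Q by (intro mult_right_mono) (simp_all add: Suc_le_eq)
      finally show ?thesis .
    qed
    moreover have "P * t * (card {w \<in> K. \<psi>' E w = y} - 1) < S" if K: "maximal_clique E K" for K y
    proof -
      let ?B = "{w \<in> K. \<psi>' E w = y}" and ?y = "y div (\<delta> + 1)"
      let ?A = "{w \<in> K. \<psi> E w = ?y}"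
      have dv: "\<psi>' E v div (\<delta> + 1) = \<psi> E v" for v 
        using lt[of v] unfolding \<psi>'_def by (simp del: add_Suc_right add_Suc mult_Suc_right)
      have sub: "?B \<subseteq> ?A" by (auto simp only: dv[symmetric] mem_Collect_eq)
      have finA: "finite ?A" using finite_maximal_clique[OF g(1) K] by simp
      have "inj_on (\<lambda>u. rank_in ?A u div t) ?B"
      proof (rule inj_onI, rule ccontr)
        fix u w assume uw: "u \<in> ?B" "w \<in> ?B" "rank_in ?A u div t = rank_in ?A w div t" "u \<noteq> w"
        have eq: "\<psi> E u = ?y" "\<psi> E w = ?y" using uw sub by blast+
        then have "w \<in> connector t E (\<psi> E) u"
          using uw K unfolding connector_def cliques_at_def by auto
        then have "\<phi> E u \<noteq> \<phi> E w" using col by (auto simp: colors_def)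
        moreover have "\<phi> E u = \<phi> E w" using uw eq by (auto simp: \<psi>'_def)
        ultimately show False by simp
      qed
      then have "t * (card ?B - 1) \<le> card ?A - 1" by (rule card_distinct_blocks[OF finA sub])
      then have "P * (t * (card ?B - 1)) \<le> P * (card ?A - 1)" by (rule mult_left_mono) simp
      also have "\<dots> < S" using P K by blast
      finally show ?thesis by (simp add: mult.assoc)
    qed
    ultimately show ?thesis by blast
  qed
  ultimately show ?thesis by blast
qed

lemma levels:
  assumes r: "2 \<le> r" and c: "loc r c" and t: "\<And>i. i < k \<Longrightarrow> 0 < t i"
    and R: "\<And>i. i < k \<Longrightarrow> colorable_in m (min (D * (t i - 1)) \<Delta>) R" and "j \<le> k"
  shows "\<exists>\<psi>. loc (r + j * (R + 1)) \<psi> \<and> (\<forall>V E. simple_graph V E \<longrightarrow> V \<noteq> {} \<longrightarrow>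
    diversity V E = D \<longrightarrow> max_degree V E = \<Delta> \<longrightarrow> colors (\<lambda>v. {w. E v w}) m (c E) \<longrightarrow>
    (\<forall>v. \<psi> E v < (\<Prod>i<j. min (D * (t i - 1)) \<Delta> + 1)) \<and>
    (\<forall>K y. maximal_clique E K \<longrightarrow> (\<Prod>i<j. t i) * (card {w \<in> K. \<psi> E w = y} - 1) < max_clique_size V E))"
  using \<open>j \<le> k\<close>
proof (induction j)
  case 0
  have "card K - 1 < max_clique_size V E"
    if g: "simple_graph V E" "V \<noteq> {}" and K: "maximal_clique E K" for V E K
  proof -
    obtain v where v: "v \<in> V" using g by blast
    then have "card {v} \<le> max_clique_size V E"
      by (intro card_clique_le[OF g(1)]) (simp add: is_clique_def)
    then have pos: "0 < max_clique_size V E" by simp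
    show ?thesis
    proof (cases "K \<subseteq> V")
      case True
      then have "card K \<le> max_clique_size V E"
        using K by (intro card_clique_le[OF g(1)]) (simp add: is_clique_def maximal_clique_def)
      then show ?thesis using pos by linarith
    next
      \<comment> \<open>A maximal clique that leaves V is a single isolated number.\<close>
      case False
      then obtain a where a: "a \<in> K" "a \<notin> V" by blast
      have "x = a" if "x \<in> K" for x
      proof (rule ccontr)
        assume "x \<noteq> a"
        then have "E a x" using K a(1) that unfolding maximal_clique_def by metis
        then show False using simple_graph_edge[OF g(1)] a(2) by blast
      qed
      then have "K = {a}" using a(1) by blast
      then show ?thesis using pos by simp
    qed
  qed
  then have "card {w \<in> K. 0 = y} - 1 < max_clique_size V E"
    if "simple_graph V E" "V \<noteq> {}" "maximal_clique E K" for V E K and y :: nat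
    using that by (cases "y = 0") fastforce+
  then show ?case
    by (intro exI[of _ "\<lambda>E v. 0"]) (simp add: loc_def)
next
  case (Suc j)
  then obtain \<psi> where L: "loc (r + j * (R + 1)) \<psi>" and
    IH: "\<And>V E. simple_graph V E \<Longrightarrow> V \<noteq> {} \<Longrightarrow>
    diversity V E = D \<Longrightarrow> max_degree V E = \<Delta> \<Longrightarrow> colors (\<lambda>v. {w. E v w}) m (c E) \<Longrightarrow>
    (\<forall>v. \<psi> E v < (\<Prod>i<j. min (D * (t i - 1)) \<Delta> + 1)) \<and>
    (\<forall>K y. maximal_clique E K \<longrightarrow> (\<Prod>i<j. t i) * (card {w \<in> K. \<psi> E w = y} - 1) < max_clique_size V E)" by auto
  have "loc (r + j * (R + 1)) c" "2 \<le> r + j * (R + 1)" "j < k"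
    using r Suc.prems by (auto intro: loc_mono[OF c])
  note LS = level_step[OF L this(2,1) t[OF this(3)] refl R[OF this(3)]]
  obtain \<psi>' where L': "loc (r + j * (R + 1) + (R + 1)) \<psi>'" and
    S: "\<And>V E P S Q. simple_graph V E \<Longrightarrow> V \<noteq> {} \<Longrightarrow>
    diversity V E = D \<Longrightarrow> max_degree V E = \<Delta> \<Longrightarrow> colors (\<lambda>v. {w. E v w}) m (c E) \<Longrightarrow>
    (\<forall>v. \<psi> E v < Q) \<Longrightarrow> (\<forall>K y. maximal_clique E K \<longrightarrow> P * (card {w \<in> K. \<psi> E w = y} - 1) < S) \<Longrightarrow>
    (\<forall>v. \<psi>' E v < Q * (min (D * (t j - 1)) \<Delta> + 1)) \<and>
    (\<forall>K y. maximal_clique E K \<longrightarrow> P * t j * (card {w \<in> K. \<psi>' E w = y} - 1) < S)"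
    using LS by blast
  have "(\<forall>v. \<psi>' E v < (\<Prod>i<Suc j. min (D * (t i - 1)) \<Delta> + 1)) \<and>
    (\<forall>K y. maximal_clique E K \<longrightarrow> (\<Prod>i<Suc j. t i) * (card {w \<in> K. \<psi>' E w = y} - 1) < max_clique_size V E)"
    if "simple_graph V E" "V \<noteq> {}" "diversity V E = D" "max_degree V E = \<Delta>"
      "colors (\<lambda>v. {w. E v w}) m (c E)" for V E
    unfolding prod.lessThan_Suc
    using S[OF that conjunct1[OF IH[OF that]] conjunct2[OF IH[OF that]]] .
  moreover have "loc (r + Suc j * (R + 1)) \<psi>'" using L' by (rule loc_mono) simp
  ultimately show ?case by blast
qed

lemma clique_in_maximal_clique:
  assumes g: "simple_graph V E" and C: "is_clique V E C" "C \<noteq> {}"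
  shows "\<exists>K. maximal_clique E K \<and> C \<subseteq> K"
proof -
  let ?C = "{K. is_clique V E K \<and> C \<subseteq> K}"
  have "finite ?C" by (rule finite_subset[OF _ finite_cliques[OF g]]) blast
  moreover have "C \<in> ?C" using C by simp
  ultimately obtain K where K: "K \<in> ?C" and mx: "\<And>K'. K' \<in> ?C \<Longrightarrow> K \<subseteq> K' \<Longrightarrow> K = K'"
    using finite_has_maximal2[of ?C C] by metis
  have "\<exists>a\<in>K. \<not> E a x" if x: "x \<notin> K" for x
  proof (rule ccontr)
    assume "\<not> ?thesis"
    then have all: "\<forall>a\<in>K. E a x" by blast
    then have "x \<in> V" "\<forall>a\<in>K. E x a" using K C(2) simple_graph_edge[OF g] by blast+
    then have "insert x K \<in> ?C" using K all by (auto simp: is_clique_def)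
    then show False using mx x by blast
  qed
  then show ?thesis using K unfolding maximal_clique_def is_clique_def by blast
qed

lemma edge_in_maximal_clique:
  assumes g: "simple_graph V E" and uw: "E u w"
  shows "\<exists>K. maximal_clique E K \<and> u \<in> K \<and> w \<in> K"
proof -
  have "is_clique V E {u, w}" using simple_graph_edge[OF g uw] uw by (auto simp: is_clique_def)
  from clique_in_maximal_clique[OF g this] show ?thesis by auto
qed

lemma diversity_pos:
  assumes g: "simple_graph V E" and "V \<noteq> {}"
  shows "0 < diversity V E"
proof -
  obtain v where v: "v \<in> V" using assms(2) by blast
  then have "is_clique V E {v}" by (simp add: is_clique_def)
  from clique_in_maximal_clique[OF g this] have "cliques_at E v \<noteq> {}" by (auto simp: cliques_at_def)
  then show ?thesis using card_cliques_at[OF g v] by (metis card_gt_0_iff less_le_trans)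
qed

text \<open>Adjacent vertices share a maximal clique. If they had equal colours, its monochromatic
  part would have size minus one at least 1, contradicting the invariant once the product is at
  least S.\<close>

lemma levels_coloring:
  assumes r: "2 \<le> r" and c: "loc r c" and t: "\<And>i. i < k \<Longrightarrow> 0 < t i"
    and R: "\<And>i. i < k \<Longrightarrow> colorable_in m (min (D * (t i - 1)) \<Delta>) R"
    and S: "S \<le> (\<Prod>i<k. t i)"
  shows "\<exists>\<psi>. loc (r + k * (R + 1)) \<psi> \<and> (\<forall>V E. simple_graph V E \<longrightarrow> V \<noteq> {} \<longrightarrow>
    diversity V E = D \<longrightarrow> max_degree V E = \<Delta> \<longrightarrow> max_clique_size V E = S \<longrightarrow>
    colors (\<lambda>v. {w. E v w}) m (c E) \<longrightarrow>
    colors (\<lambda>v. {w. E v w}) (\<Prod>i<k. min (D * (t i - 1)) \<Delta> + 1) (\<psi> E))"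
proof -
  obtain \<psi> where L: "loc (r + k * (R + 1)) \<psi>" and
    I: "\<And>V E. simple_graph V E \<Longrightarrow> V \<noteq> {} \<Longrightarrow>
    diversity V E = D \<Longrightarrow> max_degree V E = \<Delta> \<Longrightarrow> colors (\<lambda>v. {w. E v w}) m (c E) \<Longrightarrow>
    (\<forall>v. \<psi> E v < (\<Prod>i<k. min (D * (t i - 1)) \<Delta> + 1)) \<and>
    (\<forall>K y. maximal_clique E K \<longrightarrow> (\<Prod>i<k. t i) * (card {w \<in> K. \<psi> E w = y} - 1) < max_clique_size V E)"
    using levels[where j = k and k = k and t = t, OF r c t R order_refl] by blast
  have "colors (\<lambda>v. {w. E v w}) (\<Prod>i<k. min (D * (t i - 1)) \<Delta> + 1) (\<psi> E)"
    if A: "simple_graph V E" "V \<noteq> {}" "diversity V E = D" "max_degree V E = \<Delta>"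
      and SV: "max_clique_size V E = S" and cE: "colors (\<lambda>v. {w. E v w}) m (c E)" for V E
  proof -
    note I = I[OF A cE]
    have "\<psi> E u \<noteq> \<psi> E w" if e: "E u w" for u w
    proof
      assume eq: "\<psi> E u = \<psi> E w"
      obtain K where K: "maximal_clique E K" "u \<in> K" "w \<in> K" using edge_in_maximal_clique[OF A(1) e] by blast
      let ?B = "{x \<in> K. \<psi> E x = \<psi> E w}"
      have "u \<noteq> w" using simple_graph_edge[OF A(1) e] by simp
      moreover have "card {u, w} \<le> card ?B"
        using finite_maximal_clique[OF A(1) K(1)] K eq by (intro card_mono) auto
      ultimately have "1 \<le> card ?B - 1" by simp
      then have "S * 1 \<le> (\<Prod>i<k. t i) * (card ?B - 1)" using S by (intro mult_mono) simp_all
      then show False using I K(1) SV by (metis not_less mult_1_right)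
    qed
    then show ?thesis using I by (simp add: colors_def)
  qed
  then show ?thesis using L by blast
qed

section \<open>Round and colour counts\<close>

lemma colors_mono: "colors H m c \<Longrightarrow> m \<le> m' \<Longrightarrow> colors H m' c"
  unfolding colors_def by (meson less_le_trans)

text \<open>The palette after a reduction step when \<Delta> \<le> d. If d < \<Delta>, the step
  already reaches the target 2 * (\<Delta>^2 + 1)^2, so the iteration can be analysed without
  \<Delta>.\<close>

definition linial_size :: "nat \<Rightarrow> nat" where
  "linial_size m = 2 * ((floorlog 2 m)^2 + 1)^2"

text \<open>Vertices without neighbours, which include all numbers outside \<open>V\<close>, start with colour \<open>0\<close>, so that
  the colour bound holds for every natural number.\<close>
lemma linial_iterate:
  shows "\<exists>c. loc (Suc k) c \<and> (\<forall>V E. simple_graph V E \<longrightarrow> V \<subseteq> {..<N} \<longrightarrow> V \<noteq> {} \<longrightarrow> max_degree V E = \<Delta> \<longrightarrow>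
    colors (\<lambda>v. {w. E v w}) (max (2 * (\<Delta>^2 + 1)^2) ((linial_size ^^ k) N)) (c E))"
proof (induction k)
  case 0
  let ?c = "\<lambda>E v. if {w. E v w} = {} then 0 else v"
  have "loc (Suc 0) ?c" by (rule locI) simp
  moreover have "colors (\<lambda>v. {w. E v w}) N (?c E)" if g: "simple_graph V E" and V: "V \<subseteq> {..<N}" "V \<noteq> {}" for V E
    unfolding colors_def
  proof (intro allI conjI ballI)
    fix v
    show "?c E v < N" using V simple_graph_edge[OF g, of v] by (fastforce split: if_splits)
    fix w assume "w \<in> {w. E v w}"
    then have "E v w" "E w v" "v \<noteq> w" using simple_graph_edge[OF g] by blast+
    then show "?c E v \<noteq> ?c E w" by auto
  qed
  then have "colors (\<lambda>v. {w. E v w}) (max (2 * (\<Delta>^2 + 1)^2) N) (?c E)"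
    if "simple_graph V E" "V \<subseteq> {..<N}" "V \<noteq> {}" for V E
    using that by (meson colors_mono max.cobounded2)
  ultimately show ?case by (intro exI[of _ ?c]) simp
next
  case (Suc k)
  let ?B = "2 * (\<Delta>^2 + 1)^2" and ?M = "(linial_size ^^ k) N"
  obtain c where L: "loc (Suc k) c" and c: "\<And>V E. simple_graph V E \<Longrightarrow> V \<subseteq> {..<N} \<Longrightarrow> V \<noteq> {} \<Longrightarrow>
      max_degree V E = \<Delta> \<Longrightarrow> colors (\<lambda>v. {w. E v w}) (max ?B ?M) (c E)"
    using Suc by blast
  show ?case
  proof (cases "?M \<le> ?B")
    case True
    then have le: "max ?B ?M \<le> max ?B ((linial_size ^^ Suc k) N)" by simp
    show ?thesis using colors_mono[OF c le] loc_mono[OF L le_SucI[OF order_refl]] by (intro exI[of _ c]) blast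
  next
    case False
    define d where "d = floorlog 2 ?M"
    have "?M < 2 ^ d" using floorlog_bounds[of ?M 2] False unfolding d_def by simp
    then have M: "?M < 2 ^ (d + 1)" by simp
    have nb: "loc (Suc k) (\<lambda>E v. {w. E v w})" by (rule locI) simp
    have sub: "sub_nbrs (\<lambda>E v. {w. E v w})" by (simp add: sub_nbrs_def)
    obtain c' where L': "loc (Suc (Suc k)) c'" and c': "\<And>E. nbr_graph (\<lambda>v. {w. E v w}) \<Delta> \<Longrightarrow>
      colors (\<lambda>v. {w. E v w}) ?M (c E) \<Longrightarrow> colors (\<lambda>v. {w. E v w}) (2 * (\<Delta> * d + 1)^2) (c' E)"
      using linial_step[OF nb sub L M, of \<Delta>] by blast
    have size: "2 * (\<Delta> * d + 1)^2 \<le> max ?B ((linial_size ^^ Suc k) N)"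
    proof (cases "\<Delta> \<le> d")
      case True
      then have "2 * (\<Delta> * d + 1)^2 \<le> 2 * (d^2 + 1)^2"
        by (intro mult_left_mono power_mono add_right_mono) (simp_all add: power2_eq_square)
      also have "\<dots> = (linial_size ^^ Suc k) N" by (simp add: linial_size_def d_def)
      finally show ?thesis by (rule max.coboundedI2)
    next
      case False
      then have "2 * (\<Delta> * d + 1)^2 \<le> 2 * (\<Delta>^2 + 1)^2"
        by (intro mult_left_mono power_mono add_right_mono) (simp_all add: power2_eq_square)
      then show ?thesis by (rule max.coboundedI1)
    qed
    have "colors (\<lambda>v. {w. E v w}) (max ?B ((linial_size ^^ Suc k) N)) (c' E)"
      if g: "simple_graph V E" and V: "V \<subseteq> {..<N}" "V \<noteq> {}" and \<Delta>: "max_degree V E = \<Delta>" for V E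
    proof -
      have "colors (\<lambda>v. {w. E v w}) ?M (c E)" using c[OF g V \<Delta>] False by (simp add: max_def)
      moreover have "nbr_graph (\<lambda>v. {w. E v w}) \<Delta>" using nbrs_graph[OF g V(2)] \<Delta> by simp
      ultimately show ?thesis using colors_mono[OF c' size] by blast
    qed
    with L' show ?thesis by blast
  qed
qed

lemma linial_size_le:
  assumes "1 \<le> m" "real m \<le> x"
  shows "real (linial_size m) \<le> 2 * ((log 2 x + 1)^2 + 1)^2"
proof -
  have "2 ^ (floorlog 2 m - 1) \<le> m" using floorlog_bounds[of m 2] assms(1) by simp
  then have "2 ^ (floorlog 2 m - 1) \<le> real m" by (metis of_nat_le_iff of_nat_numeral of_nat_power)
  then have "real (floorlog 2 m - 1) \<le> log 2 (real m)"
    using assms(1) by (subst le_log_iff) (simp_all add: powr_realpow)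
  also have "\<dots> \<le> log 2 x" using assms by simp
  finally have "real (floorlog 2 m) \<le> log 2 x + 1" by linarith
  then have "real (linial_size m) \<le> 2 * ((log 2 x + 1)^2 + 1)^2"
    unfolding linial_size_def of_nat_mult of_nat_power of_nat_add of_nat_numeral of_nat_1
    by (intro mult_left_mono power_mono add_right_mono) simp_all
  then show ?thesis .
qed

text \<open>One step yields about 2 * (log m)^4, which is too large to compare with a logarithm; two
  steps yield a power of log log, eventually below log N even from N^c.\<close>

lemma linial_size_twice:
  assumes "1 \<le> (c :: nat)"
  shows "\<exists>N0. \<forall>N\<ge>N0. real (linial_size (linial_size (N ^ c))) \<le> log 2 (real N)"
proof -
  define c' where "c' = real c"
  have "c' > 0" using assms by (simp add: c'_def)
  then have "eventually (\<lambda>x::real. 2 * ((log 2 (2 * ((c' * log 2 x + 1)^2 + 1)^2) + 1)^2 + 1)^2 \<le> log 2 x) at_top"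
    by real_asymp
  then obtain x0 where x0: "\<And>x. x \<ge> x0 \<Longrightarrow> 2 * ((log 2 (2 * ((c' * log 2 x + 1)^2 + 1)^2) + 1)^2 + 1)^2 \<le> log 2 x"
    by (auto simp: eventually_at_top_linorder)
  have "real (linial_size (linial_size (N ^ c))) \<le> log 2 (real N)" if N: "nat \<lceil>x0\<rceil> + 1 \<le> N" for N
  proof -
    have N1: "1 \<le> N ^ c" "0 < N" using N by (simp_all add: Suc_le_eq)
    have "log 2 (real (N ^ c)) = c' * log 2 (real N)"
      unfolding c'_def of_nat_power using N1(2) by (simp add: log_nat_power)
    then have "real (linial_size (N ^ c)) \<le> 2 * ((c' * log 2 (real N) + 1)^2 + 1)^2"
      using linial_size_le[OF N1(1) order_refl] by simp
    moreover have "1 \<le> linial_size (N ^ c)" by (simp add: linial_size_def)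
    ultimately have "real (linial_size (linial_size (N ^ c))) \<le>
      2 * ((log 2 (2 * ((c' * log 2 (real N) + 1)^2 + 1)^2) + 1)^2 + 1)^2" by (intro linial_size_le)
    also have "\<dots> \<le> log 2 (real N)" using N by (intro x0) linarith
    finally show ?thesis .
  qed
  then show ?thesis by blast
qed

section \<open>Iterated logarithms and the initial colouring\<close>

lemma ln2_ge_half: "1 / 2 \<le> ln (2 :: real)"
  using ln_le_minus_one[of "1 / 2 :: real"] by (simp add: ln_div)

lemma log2_le_minus_one:
  assumes "2 \<le> (y :: real)"
  shows "log 2 y \<le> y - 1"
proof -
  have "log 2 y = 1 + ln (y / 2) / ln 2"
    using assms by (simp add: log_def ln_div field_simps)
  also have "\<dots> \<le> 1 + (y / 2 - 1) / (1 / 2)"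
    using ln_le_minus_one[of "y / 2"] ln2_ge_half assms
    by (intro add_left_mono frac_le) simp_all
  also have "\<dots> \<le> y - 1" using assms by (simp add: field_simps)
  finally show ?thesis .
qed

text \<open>Makes the \<open>LEAST\<close> in \<open>log_star\<close> meaningful. From 2 on, a
  logarithm lowers the argument by at least 1, so the ceiling decreases.\<close>

lemma log_iterate_le_one: "\<exists>k. ((\<lambda>z. log 2 z) ^^ k) y \<le> 1"
proof (induction "nat \<lceil>y\<rceil>" arbitrary: y rule: less_induct)
  case less
  consider "y \<le> 1" | "1 < y" "y < 2" | "2 \<le> y" by linarith
  then show ?case
  proof cases
    case 1
    then show ?thesis by (intro exI[of _ 0]) simp
  next
    case 2
    then have "log 2 y \<le> 1" by simp
    then show ?thesis by (intro exI[of _ 1]) simp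
  next
    case 3
    then have "nat \<lceil>log 2 y\<rceil> < nat \<lceil>y\<rceil>" using log2_le_minus_one[OF 3] by linarith
    from less[OF this] obtain k where "((\<lambda>z. log 2 z) ^^ k) (log 2 y) \<le> 1" by blast
    then show ?thesis by (intro exI[of _ "Suc k"]) (simp only: funpow_Suc_right comp_def)
  qed
qed

text \<open>Two reduction steps do at least as well as one logarithm while the palette exceeds N0; y
  is the iterated logarithm that dominates it.\<close>

lemma linial_size_log_star:
  assumes N0: "\<And>N. N0 \<le> N \<Longrightarrow> real (linial_size (linial_size N)) \<le> log 2 (real N)"
    and k: "((\<lambda>z. log 2 z) ^^ k) y \<le> 1" and M: "real M \<le> y"
  shows "\<exists>j\<le>2 * k. (linial_size ^^ j) M \<le> max 1 N0"
  using k M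
proof (induction k arbitrary: y M)
  case 0
  then show ?case by (intro exI[of _ 0]) simp
next
  case (Suc k)
  show ?case
  proof (cases "M \<le> max 1 N0")
    case True
    then show ?thesis by (intro exI[of _ 0]) simp
  next
    case False
    then have "real (linial_size (linial_size M)) \<le> log 2 (real M)" using N0 by simp
    also have "\<dots> \<le> log 2 y" using Suc.prems(2) False by simp
    finally obtain j where "j \<le> 2 * k" "(linial_size ^^ j) (linial_size (linial_size M)) \<le> max 1 N0"
      using Suc.IH[of "log 2 y"] Suc.prems(1) by (auto simp only: funpow_Suc_right comp_def)
    then show ?thesis by (intro exI[of _ "Suc (Suc j)"]) (simp only: funpow_Suc_right comp_def, simp)
  qed
qed

lemma linial_coloring:
  assumes c: "1 \<le> c"
  shows "\<exists>K0. \<forall>n \<Delta>. 1 \<le> n \<longrightarrow> (\<exists>r col. r \<le> 2 * log_star (real n) + 3 \<and> loc r col \<and>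
    (\<forall>V E. simple_graph V E \<longrightarrow> V \<subseteq> {..<n ^ c} \<longrightarrow> V \<noteq> {} \<longrightarrow> max_degree V E = \<Delta> \<longrightarrow>
      colors (\<lambda>v. {w. E v w}) (max (2 * (\<Delta>^2 + 1)^2) K0) (col E)))"
proof -
  obtain N0 where N0: "\<And>N. N0 \<le> N \<Longrightarrow> real (linial_size (linial_size (N ^ c))) \<le> log 2 (real N)"
    using linial_size_twice[OF c] by blast
  obtain N1 where N1: "\<And>N. N1 \<le> N \<Longrightarrow> real (linial_size (linial_size (N ^ 1))) \<le> log 2 (real N)"
    using linial_size_twice[of 1] by auto
  \<comment> \<open>N0 ^ c covers the small n, where the identifiers already serve as colours; N1 is
    where the iteration stops for large n.\<close>
  define K0 where "K0 = max (max 1 N1) (N0 ^ c)"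
  have "\<exists>r col. r \<le> 2 * log_star (real n) + 3 \<and> loc r col \<and>
    (\<forall>V E. simple_graph V E \<longrightarrow> V \<subseteq> {..<n ^ c} \<longrightarrow> V \<noteq> {} \<longrightarrow> max_degree V E = \<Delta> \<longrightarrow>
      colors (\<lambda>v. {w. E v w}) (max (2 * (\<Delta>^2 + 1)^2) K0) (col E))" if n: "1 \<le> n" for n \<Delta>
  proof -
    have "\<exists>j\<le>2 * log_star (real n) + 2. (linial_size ^^ j) (n ^ c) \<le> K0"
    proof (cases "n \<le> N0")
      case True
      then have "n ^ c \<le> K0" by (simp add: K0_def le_max_iff_disj power_mono)
      then show ?thesis by (intro exI[of _ 0]) simp
    next
      case False
      have "log 2 (real n) \<le> real n"
      proof (cases "2 \<le> n")
        case True
        then show ?thesis using log2_le_minus_one[of "real n"] by simp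
      next
        case False
        then have "n = 1" using n by simp
        then show ?thesis by simp
      qed
      \<comment> \<open>Two preliminary steps bring the identifiers from n^c below n, so that the
        count is in terms of \<open>log_star\<close> of n itself.\<close>
      then have le: "real (linial_size (linial_size (n ^ c))) \<le> real n" using N0[of n] False by linarith
      have star: "((\<lambda>z. log 2 z) ^^ log_star (real n)) (real n) \<le> 1"
        unfolding log_star_def by (rule LeastI_ex[OF log_iterate_le_one])
      obtain j where "j \<le> 2 * log_star (real n)"
        "(linial_size ^^ j) (linial_size (linial_size (n ^ c))) \<le> max 1 N1"
        using linial_size_log_star[OF _ star le, of N1] N1 by (auto simp only: power_one_right)
      then show ?thesis
        by (intro exI[of _ "Suc (Suc j)"]) (simp only: funpow_Suc_right comp_def, simp add: K0_def)
    qed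
    then obtain j where j: "j \<le> 2 * log_star (real n) + 2" "(linial_size ^^ j) (n ^ c) \<le> K0" by blast
    obtain col where L: "loc (Suc j) col" and col: "\<And>V E. simple_graph V E \<Longrightarrow> V \<subseteq> {..<n ^ c} \<Longrightarrow>
      V \<noteq> {} \<Longrightarrow> max_degree V E = \<Delta> \<Longrightarrow>
      colors (\<lambda>v. {w. E v w}) (max (2 * (\<Delta>^2 + 1)^2) ((linial_size ^^ j) (n ^ c))) (col E)"
      using linial_iterate[of j "n ^ c" \<Delta>] by blast
    have size: "max (2 * (\<Delta>^2 + 1)^2) ((linial_size ^^ j) (n ^ c)) \<le> max (2 * (\<Delta>^2 + 1)^2) K0"
      using j(2) by (rule max.mono[OF order_refl])
    show ?thesis using L colors_mono[OF col size] j(1) by (intro exI[of _ "Suc j"] exI[of _ col]) simp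
  qed
  then show ?thesis by blast
qed

section \<open>Choice of parameters\<close>

lemma colorable_in_mono:
  assumes "colorable_in m \<delta> R" "R \<le> R'"
  shows "colorable_in m \<delta> R'"
  using assms loc_mono[where r = "_ + R" and s = "_ + R'"] unfolding colorable_in_def
  by (meson add_left_mono)

lemma square_less_power: "(k + 10)^2 < 2 ^ (k + 15)" for k :: nat
proof (induction k)
  case (Suc k)
  have "(Suc k + 10)^2 \<le> 2 * (k + 10)^2" by (simp add: power2_eq_square algebra_simps)
  also have "\<dots> < 2 * 2 ^ (k + 15)" using Suc by (intro mult_strict_left_mono) simp_all
  also have "\<dots> = 2 ^ (Suc k + 15)" by (simp only: add_Suc power_Suc)
  finally show ?case .
qed simp

lemma colorable_in_sqrt:
  assumes m: "ln (real m + 1) \<le> K * ln (real \<Delta> + 2)" and \<delta>: "\<delta> \<le> \<Delta>" and K: "0 \<le> K"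
  shows "\<exists>R. colorable_in m \<delta> R \<and>
    real R \<le> 672 * (4 * K + 56)^2 * sqrt (real \<delta> + 1) * ln (real \<Delta> + 2) ^ 3"
proof -
  define y where "y = ln (real \<Delta> + 2)"
  define q where "q = sqrt (real \<delta> + 1)"
  define a where "a = nat \<lceil>q\<rceil>"
  define l where "l = nat \<lceil>log 2 ((real m + 1) * real a)\<rceil>"
  \<comment> \<open>The code needs d logarithmic in a', while a' contains d^2. Of the exponent 2 * l
    + 21, one l pays for (m + 1) * a, and l + 15 pays for (l + 10)^2 by
    \<open>square_less_power\<close>.\<close>
  define d where "d = 2 * l + 20"
  define a' where "a' = 8 * d * d * a"
  define j where "j = nat \<lceil>log 2 (real \<delta> + 1)\<rceil>"
  have q: "1 \<le> q" by (simp add: q_def)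
  have a: "q \<le> real a" "real a \<le> 2 * q" "0 < a" using q unfolding a_def by linarith+
  have y: "1 / 2 \<le> y"
    using ln2_ge_half unfolding y_def by (rule order_trans) simp
  have log_le: "log 2 x \<le> 2 * ln x" if "1 \<le> x" for x :: real
  proof -
    have "log 2 x \<le> ln x / (1 / 2)"
      unfolding log_def using ln2_ge_half that by (intro frac_le) simp_all
    then show ?thesis by simp
  qed
  have M: "\<delta> + 1 \<le> 2 * a * a"
  proof -
    have "real \<delta> + 1 = q * q" by (simp add: q_def)
    also have "\<dots> \<le> real a * real a" using a q by (intro mult_mono) simp_all
    finally have "real (\<delta> + 1) \<le> real (2 * a * a)" by (simp add: mult.assoc)
    then show ?thesis by (simp only: of_nat_le_iff)
  qed
  have l: "(m + 1) * a \<le> 2 ^ l"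
  proof -
    have pos: "0 < (real m + 1) * real a" using a by simp
    have "log 2 ((real m + 1) * real a) \<le> real l" unfolding l_def by linarith
    then have "(real m + 1) * real a \<le> 2 ^ l"
      using pos by (simp add: log_le_iff powr_realpow)
    then have "real ((m + 1) * a) \<le> real (2 ^ l)" by (simp add: algebra_simps)
    then show ?thesis by (simp only: of_nat_le_iff)
  qed
  have big: "(m + 1) * (2 * a') < 2 ^ (d + 1)"
  proof -
    have "(m + 1) * (2 * a') = 64 * (l + 10)^2 * ((m + 1) * a)"
      by (simp add: a'_def d_def power2_eq_square algebra_simps)
    also have "\<dots> \<le> 64 * (l + 10)^2 * 2 ^ l" using l by (rule mult_left_mono) simp
    also have "\<dots> < 64 * 2 ^ (l + 15) * 2 ^ l" using square_less_power[of l] by simp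
    also have "\<dots> = 2 ^ (d + 1)" by (simp add: d_def power_add power_mult power2_eq_square power_mult_distrib flip: power_mult_distrib)
    finally show ?thesis .
  qed
  have aa': "a \<le> a'" unfolding a'_def d_def by simp
  have "(m + 1) * (2 * a) \<le> (m + 1) * (2 * a')" using aa' by (intro mult_left_mono) simp_all
  then have "(m + 1) * (2 * a) < 2 ^ (d + 1)" using big by linarith
  then obtain g where g: "spread g m a d" using spread_exists a(3) by blast
  obtain f where f: "spread f m a' d" using spread_exists[OF _ big] a(3) aa' by auto
  have j: "\<delta> < 2 ^ j"
  proof -
    have "log 2 (real \<delta> + 1) \<le> real j" unfolding j_def by linarith
    then have "real \<delta> + 1 \<le> 2 ^ j" by (simp add: log_le_iff powr_realpow)
    then have "real \<delta> < 2 ^ j" by linarith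
    then have "real \<delta> < real (2 ^ j)" by (simp only: of_nat_power of_nat_numeral)
    then show ?thesis by (simp only: of_nat_less_iff)
  qed
  define R where "R = (j + 1) * (5 * a' + 2)"
  have "colorable_in m \<delta> R"
    unfolding colorable_in_def R_def
    using degree_plus_one_coloring[OF _ _ _ g f M _ _ j] by (simp add: a'_def d_def)
  \<comment> \<open>Of the three logarithms two come from d^2 in a' and one from the number of
    phases; 672 is 6 * 7 * 16.\<close>
  moreover have "real R \<le> 672 * (4 * K + 56)^2 * q * y ^ 3"
  proof -
    have ln_a: "ln (real a) \<le> ln 2 + y"
    proof -
      have "real a \<le> 2 * (real \<Delta> + 2)"
      proof -
        have "q \<le> real \<delta> + 1" unfolding q_def by (rule real_le_lsqrt) (simp_all add: power2_eq_square)
        then show ?thesis using a(2) \<delta> by simp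
      qed
      then have "ln (real a) \<le> ln (2 * (real \<Delta> + 2))" using a by simp
      also have "\<dots> = ln 2 + y" unfolding y_def by (rule ln_mult_pos) simp_all
      finally show ?thesis .
    qed
    have "log 2 ((real m + 1) * real a) \<le> 2 * ln ((real m + 1) * real a)"
      using a by (intro log_le mult_ge1_I) simp_all
    also have "ln ((real m + 1) * real a) = ln (real m + 1) + ln (real a)"
      using a by (intro ln_mult_pos) simp_all
    also have "\<dots> \<le> K * y + (1 + y)"
      using m ln_a ln_le_minus_one[of 2] unfolding y_def by linarith
    finally have "log 2 ((real m + 1) * real a) \<le> 2 * (K * y + (1 + y))" by simp
    moreover have "real l \<le> log 2 ((real m + 1) * real a) + 1"
    proof -
      have "0 \<le> log 2 ((real m + 1) * real a)" using a by (intro zero_le_log_cancel_iff[THEN iffD2] mult_ge1_I) simp_all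
      then show ?thesis unfolding l_def by linarith
    qed
    ultimately have "real d \<le> 4 * (K * y) + 4 * y + 26" unfolding d_def by simp
    also have "\<dots> \<le> (4 * K + 56) * y" using y by (simp add: algebra_simps)
    finally have d: "real d \<le> (4 * K + 56) * y" .
    have j1: "real (j + 1) \<le> 6 * y"
    proof -
      have "log 2 (real \<delta> + 1) \<le> 2 * ln (real \<delta> + 1)" by (rule log_le) simp
      also have "ln (real \<delta> + 1) \<le> y" unfolding y_def using \<delta> by simp
      finally have "log 2 (real \<delta> + 1) \<le> 2 * y" by simp
      moreover have "real j \<le> log 2 (real \<delta> + 1) + 1"
      proof -
        have "0 \<le> log 2 (real \<delta> + 1)" by simp
        then show ?thesis unfolding j_def by linarith
      qed
      ultimately show ?thesis using y by simp
    qed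
    have "real a' = 8 * (real d * real d) * real a" by (simp add: a'_def)
    also have "\<dots> \<le> 8 * (((4 * K + 56) * y) * ((4 * K + 56) * y)) * (2 * q)"
      using d a q y K by (intro mult_mono) simp_all
    finally have a'_le: "real a' \<le> 16 * (4 * K + 56)^2 * y^2 * q"
      by (simp add: power2_eq_square mult_ac)
    have "1 \<le> a'" using aa' a(3) by simp
    then have "real (5 * a' + 2) \<le> 7 * real a'" by simp
    then have "real R \<le> (6 * y) * (7 * (16 * (4 * K + 56)^2 * y^2 * q))"
      unfolding R_def of_nat_mult using j1 a'_le y q by (intro mult_mono) linarith+
    then show ?thesis by (simp add: power2_eq_square power3_eq_cube mult_ac)
  qed
  ultimately show ?thesis unfolding q_def y_def by blast
qed

text \<open>Rounding each factor greedily against the running product keeps the error of the whole product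
  within a factor \<open>2\<close>, which rounding \<open>s\<close> itself would not do when \<open>x\<close> is large.\<close>
lemma factor_sequence:
  assumes "1 \<le> (s :: real)"
  shows "\<exists>t :: nat \<Rightarrow> nat. (\<forall>i. 1 \<le> t i \<and> real (t i) \<le> 2 * s) \<and>
    real (\<Prod>i<x. t i) \<le> s ^ x \<and> s ^ x \<le> 2 * real (\<Prod>i<x. t i)"
proof (induction x)
  case 0
  show ?case using assms by (intro exI[of _ "\<lambda>_. 1"]) simp
next
  case (Suc x)
  then obtain t :: "nat \<Rightarrow> nat" where t: "\<And>i. 1 \<le> t i" "\<And>i. real (t i) \<le> 2 * s"
    "real (\<Prod>i<x. t i) \<le> s ^ x" "s ^ x \<le> 2 * real (\<Prod>i<x. t i)" by blast
  define P where "P = (\<Prod>i<x. t i)"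
  have P: "0 < real P" "real P \<le> s ^ x" "s ^ x \<le> 2 * real P"
    using t by (simp_all add: P_def prod_pos Suc_le_eq)
  define \<rho> where "\<rho> = s ^ Suc x / real P"
  have "s * real P \<le> s ^ Suc x" "s ^ Suc x \<le> 2 * s * real P" using P assms by simp_all
  then have \<rho>: "s \<le> \<rho>" "\<rho> \<le> 2 * s" unfolding \<rho>_def using P(1) by (simp_all add: field_simps)
  define u where "u = nat \<lfloor>\<rho>\<rfloor>"
  have u: "1 \<le> u" "real u \<le> \<rho>" "\<rho> \<le> 2 * real u" 
  proof -
    have "1 \<le> \<lfloor>\<rho>\<rfloor>" using \<rho> assms by linarith
    then have "real u = of_int \<lfloor>\<rho>\<rfloor>" "1 \<le> real u" unfolding u_def by simp_all
    then show "1 \<le> u" "real u \<le> \<rho>" "\<rho> \<le> 2 * real u" by linarith+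
  qed
  have prod: "(\<Prod>i<Suc x. (t(x := u)) i) = P * u"
    unfolding prod.lessThan_Suc P_def by (intro arg_cong2[where f = "(*)"] prod.cong) auto
  have "real P * real u \<le> real P * \<rho>" "real P * \<rho> \<le> 2 * (real P * real u)" using u P(1) by simp_all
  moreover have "real P * \<rho> = s ^ Suc x" unfolding \<rho>_def using P(1) by simp
  ultimately have "real (P * u) \<le> s ^ Suc x" "s ^ Suc x \<le> 2 * real (P * u)" by simp_all
  then show ?case
    using t(1,2) u(1) order_trans[OF u(2) \<rho>(2)] prod by (intro exI[of _ "t(x := u)"]) (simp only:, simp)
qed

text \<open>C and S0 depend on \<mu>, c and \<open>xf\<close> only. The labelling may depend on n,
  D, S and \<Delta>, which all vertices know, but must serve every graph with these
  parameters.\<close>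

lemma local_coloring_exists:
  fixes \<mu> :: real and c :: nat and xf :: "nat \<Rightarrow> nat"
  assumes \<mu>: "\<mu> > 0" and c: "c \<ge> 1"
    and xf_o: "(\<lambda>S. real (xf S)) \<in> o(\<lambda>S. ln (real S))"
    and xf_pos: "eventually (\<lambda>S. 1 \<le> xf S) at_top"
  shows "\<exists>C S0. \<forall>n D S \<Delta>. 1 \<le> n \<longrightarrow> 1 \<le> D \<longrightarrow> S0 \<le> S \<longrightarrow>
    (\<exists>\<psi>. loc (nat \<lceil>C * (real (xf S) * sqrt (real D * real S powr (1 / (real (xf S) + 1)))
        * (ln (real \<Delta> + 2)) ^ 3 + real (log_star (real n)) + 1)\<rceil>) \<psi> \<and>
      (\<forall>V E. simple_graph V E \<longrightarrow> V \<noteq> {} \<longrightarrow> V \<subseteq> {..<n ^ c} \<longrightarrow> diversity V E = D \<longrightarrow>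
        max_clique_size V E = S \<longrightarrow> max_degree V E = \<Delta> \<longrightarrow>
        (\<exists>M. colors (\<lambda>v. {w. E v w}) M (\<psi> E) \<and> real M \<le> (1 + \<mu>) * real S * real D ^ (xf S + 1))))"
proof -
  obtain K0 where K0: "\<And>n \<Delta>. 1 \<le> n \<Longrightarrow> \<exists>r col. r \<le> 2 * log_star (real n) + 3 \<and> loc r col \<and>
    (\<forall>V E. simple_graph V E \<longrightarrow> V \<subseteq> {..<n ^ c} \<longrightarrow> V \<noteq> {} \<longrightarrow> max_degree V E = \<Delta> \<longrightarrow>
      colors (\<lambda>v. {w. E v w}) (max (2 * (\<Delta>^2 + 1)^2) K0) (col E))"
    using linial_coloring[OF c] by blast
  \<comment> \<open>With x \<le> ln S / (2 * B) and x \<ge> 1, the root s = S^(1/(x+1)) is at least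
    exp B, hence at least 1 and at least 1 / \<mu>.\<close>
  define B where "B = max 1 (ln (1 / \<mu>))"
  have B: "1 \<le> B" "ln (1 / \<mu>) \<le> B" by (simp_all add: B_def)
  have "eventually (\<lambda>S. norm (real (xf S)) \<le> 1 / (2 * B) * norm (ln (real S))) at_top"
    using landau_o.smallD[OF xf_o, of "1 / (2 * B)"] B by simp
  then have "eventually (\<lambda>S. 1 \<le> xf S \<and> norm (real (xf S)) \<le> 1 / (2 * B) * norm (ln (real S)) \<and> 1 \<le> S) at_top"
    using xf_pos eventually_ge_at_top[of 1] by eventually_elim simp
  then obtain S0 where S0: "\<And>S. S0 \<le> S \<Longrightarrow>
      1 \<le> xf S \<and> norm (real (xf S)) \<le> 1 / (2 * B) * norm (ln (real S)) \<and> 1 \<le> S"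
    by (auto simp: eventually_at_top_linorder)
  \<comment> \<open>Makes ln (m + 1) \<le> K * ln (\<Delta> + 2) for the initial palette m; the
    doubled term absorbs the constant, since ln (\<Delta> + 2) \<ge> 1 / 2.\<close>
  define K where "K = 2 * ln (real K0 + 3) + 4"
  have K: "0 \<le> K" by (simp add: K_def)
  define C1 where "C1 = 672 * (4 * K + 56)^2"
  have C1: "0 \<le> C1" by (simp add: C1_def)
  \<comment> \<open>4 * C1 + 16 pays for the x + 1 \<le> 2 * x levels, 5 for the initial
    colouring.\<close>
  define C where "C = 4 * C1 + 16 + 5"
  have "\<exists>\<psi>. loc (nat \<lceil>C * (real (xf S) * sqrt (real D * real S powr (1 / (real (xf S) + 1)))
        * (ln (real \<Delta> + 2)) ^ 3 + real (log_star (real n)) + 1)\<rceil>) \<psi> \<and>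
      (\<forall>V E. simple_graph V E \<longrightarrow> V \<noteq> {} \<longrightarrow> V \<subseteq> {..<n ^ c} \<longrightarrow> diversity V E = D \<longrightarrow>
        max_clique_size V E = S \<longrightarrow> max_degree V E = \<Delta> \<longrightarrow>
        (\<exists>M. colors (\<lambda>v. {w. E v w}) M (\<psi> E) \<and> real M \<le> (1 + \<mu>) * real S * real D ^ (xf S + 1)))"
    if n: "1 \<le> n" and D: "1 \<le> D" and S: "S0 \<le> S" for n D S \<Delta>
  proof -
    define x where "x = xf S"
    define s where "s = real S powr (1 / (real x + 1))"
    define y where "y = ln (real \<Delta> + 2)"
    have x: "1 \<le> x" and S1: "1 \<le> S" using S0[OF S] by (simp_all add: x_def)
    then have ln0: "0 \<le> ln (real S)" by simp
    have "norm (real x) \<le> 1 / (2 * B) * norm (ln (real S))" using S0[OF S] unfolding x_def by blast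
    then have xS: "real x \<le> 1 / (2 * B) * ln (real S)"
      by (simp only: real_norm_def abs_of_nonneg[OF ln0] abs_of_nat)
    have y: "1 / 2 \<le> y"
      using ln2_ge_half unfolding y_def by (rule order_trans) simp
    have "(real x + 1) * B \<le> (2 * real x) * B" using x B by (intro mult_right_mono) simp_all
    also have "\<dots> \<le> ln (real S)" using xS B by (simp add: field_simps)
    finally have lnS: "B \<le> ln (real S) / (real x + 1)" by (simp add: field_simps)
    have s_exp: "s = exp (ln (real S) / (real x + 1))" using S1 by (simp add: s_def powr_def)
    have s_ge: "exp B \<le> s" using lnS by (simp add: s_exp)
    have s_mu: "1 / \<mu> \<le> s"
    proof -
      have "1 / \<mu> = exp (ln (1 / \<mu>))" using \<mu> by simp
      also have "\<dots> \<le> exp B" using B by simp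
      finally show ?thesis using s_ge by linarith
    qed
    have s1: "1 \<le> s" using s_ge B exp_ge_add_one_self[of B] by linarith
    have s_pow: "s ^ (x + 1) = real S"
    proof -
      have "s ^ (x + 1) = exp (real (x + 1) * (ln (real S) / (real x + 1)))"
        unfolding s_exp by (rule exp_of_nat_mult[symmetric])
      also have "real (x + 1) * (ln (real S) / (real x + 1)) = ln (real S)"
        by (simp add: field_simps add_nonneg_eq_0_iff)
      finally show ?thesis using S1 by simp
    qed
    obtain t0 :: "nat \<Rightarrow> nat" where t0: "\<And>i. 1 \<le> t0 i" "\<And>i. real (t0 i) \<le> 2 * s"
      "real (\<Prod>i<x. t0 i) \<le> s ^ x" "s ^ x \<le> 2 * real (\<Prod>i<x. t0 i)"
      using factor_sequence[OF s1, of x] by blast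
    define P where "P = (\<Prod>i<x. t0 i)"
    have P: "0 < real P" "real P \<le> s ^ x" "s ^ x \<le> 2 * real P"
      using t0 by (simp_all add: P_def prod_pos Suc_le_eq)
    have SP: "1 \<le> real S / real P" "real S / real P \<le> 2 * s"
    proof -
      have "real P \<le> s ^ x * s" using P(2) s1 by (rule_tac order_trans[OF P(2)]) simp
      then show "1 \<le> real S / real P" using P(1) s_pow by (simp add: mult.commute)
      have "s * s ^ x \<le> s * (2 * real P)" using P(3) s1 by (intro mult_left_mono) simp_all
      then show "real S / real P \<le> 2 * s" using P(1) s_pow by (simp add: field_simps)
    qed
    have P_le: "real P \<le> \<mu> * real S"
    proof -
      have "1 \<le> \<mu> * s" using s_mu \<mu> by (simp add: field_simps)
      then have "s ^ x \<le> \<mu> * s * s ^ x" using s1 by simp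
      then show ?thesis using P(2) s_pow by (simp add: mult_ac)
    qed
    \<comment> \<open>The last factor makes up for the rounding of the others: P * u lies between S
      and S + P, and P \<le> s^x = S / s \<le> \<mu> * S. Since S / P \<le> 2 * s, it stays below 3
      * s.\<close>
    define u where "u = nat \<lceil>real S / real P\<rceil>"
    have u: "real S / real P \<le> real u" "real u \<le> real S / real P + 1" "1 \<le> u"
      using SP unfolding u_def by linarith+
    define t where "t = t0(x := u)"
    have prod_t: "(\<Prod>i<x + 1. t i) = P * u"
      unfolding Suc_eq_plus1[symmetric] prod.lessThan_Suc P_def t_def
      by (intro arg_cong2[where f = "(*)"] prod.cong) auto
    have Pu: "real S \<le> real P * real u" "real P * real u \<le> real S + real P"
      using u(1,2) P(1) by (simp_all add: field_simps)
    have t: "1 \<le> t i" "real (t i) \<le> 3 * s" for i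
      using t0(1)[of i] t0(2)[of i] u SP s1 by (auto simp: t_def)
    define m where "m = max (2 * (\<Delta>^2 + 1)^2) K0"
    have m: "ln (real m + 1) \<le> K * ln (real \<Delta> + 2)"
    proof -
      let ?w = "(real \<Delta> + 2) ^ 4"
      have w1: "1 \<le> ?w" by (intro one_le_power) simp
      have "real (2 * (\<Delta>^2 + 1)^2) \<le> 2 * ((real \<Delta> + 2)^2)^2"
        unfolding of_nat_mult of_nat_power of_nat_add of_nat_numeral of_nat_1
        by (intro mult_left_mono power_mono) (simp_all add: power2_eq_square algebra_simps)
      also have "\<dots> = 2 * ?w" by (simp flip: power_mult)
      finally have "real m \<le> max (2 * ?w) (real K0)" unfolding m_def of_nat_max by (rule max.mono) simp
      also have "\<dots> \<le> 2 * ?w + real K0" using w1 by simp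
      also have "\<dots> \<le> 2 * ?w + real K0 * ?w" using mult_left_mono[OF w1, of "real K0"] by simp
      finally have "real m + 1 \<le> (real K0 + 3) * ?w" unfolding distrib_right using w1 by linarith
      then have "ln (real m + 1) \<le> ln ((real K0 + 3) * ?w)" by (intro ln_mono) simp_all
      also have "\<dots> = ln (real K0 + 3) + 4 * y"
        unfolding y_def using w1 by (subst ln_mult_pos) (simp_all add: ln_realpow)
      also have "\<dots> \<le> ln (real K0 + 3) * (2 * y) + 4 * y"
        using mult_left_mono[of 1 "2 * y" "ln (real K0 + 3)"] y by simp
      also have "\<dots> = K * y" by (simp add: K_def algebra_simps)
      finally show ?thesis by (simp add: y_def)
    qed
    define z where "z = sqrt (real D * s) * y ^ 3"
    \<comment> \<open>Lets the single extra round of each level be charged as 8 * z.\<close>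
    have z: "1 / 8 \<le> z"
    proof -
      have "1 * 1 \<le> real D * s" using D s1 by (intro mult_mono) simp_all
      then have "1 \<le> sqrt (real D * s)" by simp
      moreover have "(1 / 2) ^ 3 \<le> y ^ 3" using y by (intro power_mono) simp_all
      ultimately have "1 * (1 / 2) ^ 3 \<le> z" unfolding z_def by (intro mult_mono) simp_all
      then show ?thesis by (simp add: power3_eq_cube)
    qed
    define R where "R = nat \<lfloor>2 * C1 * z\<rfloor>"
    define \<delta> where "\<delta> i = min (D * (t i - 1)) \<Delta>" for i
    have \<delta>_le: "\<delta> i + 1 \<le> D * t i" for i
    proof -
      have "D * (t i - 1) + 1 \<le> D * (t i - 1) + D" using D by simp
      also have "\<dots> = D * t i" using t(1)[of i] by (cases "t i") simp_all
      finally show ?thesis unfolding \<delta>_def by linarith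
    qed
    have R: "colorable_in m (\<delta> i) R" for i
    proof -
      obtain R' where R': "colorable_in m (\<delta> i) R'" "real R' \<le> C1 * sqrt (real (\<delta> i) + 1) * y ^ 3"
        using colorable_in_sqrt[OF m, of "\<delta> i"] K unfolding C1_def y_def \<delta>_def by auto
      have "real (\<delta> i) + 1 \<le> real D * real (t i)" using \<delta>_le[of i] by (metis of_nat_1 of_nat_add of_nat_le_iff of_nat_mult)
      also have "\<dots> \<le> real D * (3 * s)" using t(2) by (intro mult_left_mono) simp_all
      also have "\<dots> \<le> 2^2 * (real D * s)" using s1 by simp
      finally have "sqrt (real (\<delta> i) + 1) \<le> sqrt (2^2 * (real D * s))" by simp
      also have "\<dots> = 2 * sqrt (real D * s)" by (simp add: real_sqrt_mult)
      finally have "C1 * sqrt (real (\<delta> i) + 1) * y ^ 3 \<le> C1 * (2 * sqrt (real D * s)) * y ^ 3"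
        using C1 y by (intro mult_right_mono mult_left_mono) simp_all
      also have "\<dots> = 2 * C1 * z" by (simp add: z_def)
      finally have "R' \<le> R" using R'(2) unfolding R_def by linarith
      then show ?thesis by (rule colorable_in_mono[OF R'(1)])
    qed
    obtain r col where r: "r \<le> 2 * log_star (real n) + 3" and col_loc: "loc r col" and
      col: "\<And>V E. simple_graph V E \<Longrightarrow> V \<subseteq> {..<n ^ c} \<Longrightarrow> V \<noteq> {} \<Longrightarrow> max_degree V E = \<Delta> \<Longrightarrow>
      colors (\<lambda>v. {w. E v w}) m (col E)"
      using K0[OF n, of \<Delta>] unfolding m_def by blast
    have "S \<le> (\<Prod>i<x + 1. t i)"
    proof -
      have "real S \<le> real (P * u)" using Pu by simp
      then show ?thesis unfolding prod_t by (simp only: of_nat_le_iff)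
    qed
    moreover have "loc (max 2 r) col" using col_loc by (rule loc_mono) simp
    moreover have "0 < t i" for i using t(1)[of i] by simp
    ultimately obtain \<psi> where L: "loc (max 2 r + (x + 1) * (R + 1)) \<psi>" and
      \<psi>: "\<And>V E. simple_graph V E \<Longrightarrow> V \<noteq> {} \<Longrightarrow>
    diversity V E = D \<Longrightarrow> max_degree V E = \<Delta> \<Longrightarrow> max_clique_size V E = S \<Longrightarrow>
    colors (\<lambda>v. {w. E v w}) m (col E) \<Longrightarrow>
    colors (\<lambda>v. {w. E v w}) (\<Prod>i<x + 1. \<delta> i + 1) (\<psi> E)"
      using levels_coloring[of "max 2 r" col "x + 1" t m D \<Delta> R S] R unfolding \<delta>_def by (metis max.cobounded1)
    have R1: "real (R + 1) \<le> 2 * C1 * z + 8 * z"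
    proof -
      have "0 \<le> 2 * C1 * z" using C1 z by simp
      then have "real R \<le> 2 * C1 * z" unfolding R_def by linarith
      then show ?thesis using z by simp
    qed
    have "real (max 2 r + (x + 1) * (R + 1)) \<le> C * (real x * z + real (log_star (real n)) + 1)"
    proof -
      have "real ((x + 1) * (R + 1)) \<le> (2 * real x) * (2 * C1 * z + 8 * z)"
        unfolding of_nat_mult using x R1 by (intro mult_mono) simp_all
      also have "\<dots> = (4 * C1 + 16) * (real x * z)" by (simp add: algebra_simps)
      also have "\<dots> \<le> C * (real x * z)"
        unfolding C_def using z by (intro mult_right_mono) simp_all
      finally have 1: "real ((x + 1) * (R + 1)) \<le> C * (real x * z)" .
      have "real (max 2 r) \<le> 5 * (real (log_star (real n)) + 1)" using r by (simp add: max_def)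
      also have "\<dots> \<le> C * (real (log_star (real n)) + 1)"
        unfolding C_def using C1 by (intro mult_right_mono) simp_all
      finally have 2: "real (max 2 r) \<le> C * (real (log_star (real n)) + 1)" .
      have "real (max 2 r + (x + 1) * (R + 1)) = real (max 2 r) + real ((x + 1) * (R + 1))" by (rule of_nat_add)
      also have "\<dots> \<le> C * (real (log_star (real n)) + 1) + C * (real x * z)" using 1 2 by (rule add_mono[rotated])
      also have "\<dots> = C * (real x * z + real (log_star (real n)) + 1)" by (simp add: algebra_simps)
      finally show ?thesis .
    qed
    then have "max 2 r + (x + 1) * (R + 1) \<le> nat \<lceil>C * (real x * z + real (log_star (real n)) + 1)\<rceil>" by linarith
    then have "loc (nat \<lceil>C * (real x * z + real (log_star (real n)) + 1)\<rceil>) \<psi>" by (rule loc_mono[OF L])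
    moreover have "real x * z = real (xf S) * sqrt (real D * real S powr (1 / (real (xf S) + 1))) * (ln (real \<Delta> + 2)) ^ 3"
      by (simp add: z_def x_def y_def s_def)
    moreover have "real (\<Prod>i<x + 1. \<delta> i + 1) \<le> (1 + \<mu>) * real S * real D ^ (xf S + 1)"
    proof -
      have "(\<Prod>i<x + 1. \<delta> i + 1) \<le> (\<Prod>i<x + 1. D * t i)" using \<delta>_le by (intro prod_mono) simp
      also have "\<dots> = D ^ (x + 1) * (P * u)" unfolding prod.distrib prod_t by simp
      finally have "real (\<Prod>i<x + 1. \<delta> i + 1) \<le> real (D ^ (x + 1) * (P * u))" by (simp only: of_nat_le_iff)
      also have "\<dots> = real D ^ (x + 1) * (real P * real u)" by simp
      also have "\<dots> \<le> real D ^ (x + 1) * ((1 + \<mu>) * real S)"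
        using Pu(2) P_le by (intro mult_left_mono) (simp_all add: algebra_simps)
      finally show ?thesis by (simp add: x_def mult_ac)
    qed
    ultimately show ?thesis using \<psi> col by metis
  qed
  then show ?thesis by blast
qed

theorem mainTheorem6:
  fixes \<mu> :: real and c :: nat and xf :: "nat \<Rightarrow> nat"
  assumes "\<mu> > 0"
    and "c \<ge> 1"
    and "(\<lambda>S. real (xf S)) \<in> o(\<lambda>S. ln (real S))"
    and "eventually (\<lambda>S. 1 \<le> xf S) at_top"
  shows "\<exists>(C::real) (k::nat) (S0::nat)
           (A :: nat \<Rightarrow> nat \<Rightarrow> nat \<Rightarrow> nat \<Rightarrow> nat \<times> nat set \<times> (nat \<Rightarrow> nat \<Rightarrow> bool) \<Rightarrow> nat).
    \<forall>V E. simple_graph V E \<and> V \<noteq> {} \<and> V \<subseteq> {..< card V ^ c} \<and> S0 \<le> max_clique_size V E \<longrightarrow>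
      (let n = card V; D = diversity V E; S = max_clique_size V E; \<Delta> = max_degree V E;
           x = xf S;
           T = nat \<lceil>C * (real x * sqrt (real D * real S powr (1 / (real x + 1)))
                         * (ln (real \<Delta> + 2)) ^ k + real (log_star (real n)) + 1)\<rceil>;
           col = (\<lambda>v. A n D S \<Delta> (local_view V E T v))
       in proper_coloring V E col \<and>
          (\<forall>v\<in>V. 1 \<le> col v \<and> real (col v) \<le> (1 + \<mu>) * real S * real D ^ (x + 1)))"
proof -
  obtain C S0 where CS: "\<And>n D S \<Delta>. 1 \<le> n \<Longrightarrow> 1 \<le> D \<Longrightarrow> S0 \<le> S \<Longrightarrow>
    \<exists>\<psi>. loc (nat \<lceil>C * (real (xf S) * sqrt (real D * real S powr (1 / (real (xf S) + 1)))
        * (ln (real \<Delta> + 2)) ^ 3 + real (log_star (real n)) + 1)\<rceil>) \<psi> \<and>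
      (\<forall>V E. simple_graph V E \<longrightarrow> V \<noteq> {} \<longrightarrow> V \<subseteq> {..<n ^ c} \<longrightarrow> diversity V E = D \<longrightarrow>
        max_clique_size V E = S \<longrightarrow> max_degree V E = \<Delta> \<longrightarrow>
        (\<exists>M. colors (\<lambda>v. {w. E v w}) M (\<psi> E) \<and> real M \<le> (1 + \<mu>) * real S * real D ^ (xf S + 1)))"
    using local_coloring_exists[OF assms] by metis
  define T where "T n D S \<Delta> = nat \<lceil>C * (real (xf S) * sqrt (real D * real S powr (1 / (real (xf S) + 1)))
        * (ln (real \<Delta> + 2)) ^ 3 + real (log_star (real n)) + 1)\<rceil>" for n D S \<Delta> :: nat
  define correct where "correct n D S \<Delta> \<psi> \<longleftrightarrow> loc (T n D S \<Delta>) \<psi> \<and>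
      (\<forall>V E. simple_graph V E \<longrightarrow> V \<noteq> {} \<longrightarrow> V \<subseteq> {..<n ^ c} \<longrightarrow> diversity V E = D \<longrightarrow>
        max_clique_size V E = S \<longrightarrow> max_degree V E = \<Delta> \<longrightarrow>
        (\<exists>M. colors (\<lambda>v. {w. E v w}) M (\<psi> E) \<and> real M \<le> (1 + \<mu>) * real S * real D ^ (xf S + 1)))"
    for n D S \<Delta> \<psi>
  define \<psi> where "\<psi> n D S \<Delta> = (SOME \<psi>. correct n D S \<Delta> \<psi>)" for n D S \<Delta>
  have \<psi>: "correct n D S \<Delta> (\<psi> n D S \<Delta>)" if "1 \<le> n" "1 \<le> D" "S0 \<le> S" for n D S \<Delta>
  proof -
    have "\<exists>\<psi>. correct n D S \<Delta> \<psi>" unfolding correct_def T_def by (rule CS[OF that])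
    then show ?thesis unfolding \<psi>_def by (rule someI_ex)
  qed
  \<comment> \<open>A vertex outputs its label in any network compatible with its view; locality
    makes this independent of the network chosen. The added 1 is there because the theorem counts
    colours from 1.\<close>
  define A where "A n D S \<Delta> view = (SOME y. \<exists>V E v. simple_graph V E \<and> v \<in> V \<and>
    local_view V E (T n D S \<Delta>) v = view \<and> y = \<psi> n D S \<Delta> E v + 1)" for n D S \<Delta> view
  have A: "A n D S \<Delta> (local_view V E (T n D S \<Delta>) v) = \<psi> n D S \<Delta> E v + 1"
    if n: "1 \<le> n" "1 \<le> D" "S0 \<le> S" and g: "simple_graph V E" and v: "v \<in> V" for n D S \<Delta> V E v
    unfolding A_def
  proof (rule some_equality)
    fix y assume "\<exists>V' E' v'. simple_graph V' E' \<and> v' \<in> V' \<and>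
      local_view V' E' (T n D S \<Delta>) v' = local_view V E (T n D S \<Delta>) v \<and> y = \<psi> n D S \<Delta> E' v' + 1"
    then obtain V' E' v' where 1: "simple_graph V' E'" "v' \<in> V'"
      "local_view V' E' (T n D S \<Delta>) v' = local_view V E (T n D S \<Delta>) v" "y = \<psi> n D S \<Delta> E' v' + 1" by blast
    \<comment> \<open>The identifier is the first component of the view.\<close>
    have "v' = v" using arg_cong[OF 1(3), of fst] by (simp add: local_view_def)
    then have "agree (T n D S \<Delta>) E' E v" using local_view_agree[OF 1(1) g _ v] 1(2,3) by simp
    moreover have "loc (T n D S \<Delta>) (\<psi> n D S \<Delta>)" using \<psi>[OF n] by (simp add: correct_def)
    ultimately have "\<psi> n D S \<Delta> E' v = \<psi> n D S \<Delta> E v" unfolding loc_def by blast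
    then show "y = \<psi> n D S \<Delta> E v + 1" using 1(4) \<open>v' = v\<close> by simp
  qed (use g v in blast)
  show ?thesis
  proof (rule exI[of _ C], rule exI[of _ 3], rule exI[of _ S0], rule exI[of _ A], intro allI impI)
    fix V E
    assume asm: "simple_graph V E \<and> V \<noteq> {} \<and> V \<subseteq> {..< card V ^ c} \<and> S0 \<le> max_clique_size V E"
    define n D S \<Delta> where "n = card V" and "D = diversity V E" and "S = max_clique_size V E"
      and "\<Delta> = max_degree V E"
    have g: "simple_graph V E" "V \<noteq> {}" "V \<subseteq> {..<n ^ c}" "S0 \<le> S" using asm by (simp_all add: n_def S_def)
    have nD: "1 \<le> n" "1 \<le> D"
      using g simple_graph_finite[OF g(1)] diversity_pos[OF g(1,2)]
      by (simp_all add: n_def D_def Suc_le_eq card_gt_0_iff)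
    obtain M where M: "colors (\<lambda>v. {w. E v w}) M (\<psi> n D S \<Delta> E)"
      "real M \<le> (1 + \<mu>) * real S * real D ^ (xf S + 1)"
      using \<psi>[OF nD g(4), of \<Delta>] g(1-3) unfolding correct_def D_def S_def \<Delta>_def by blast
    let ?col = "\<lambda>v. A n D S \<Delta> (local_view V E (T n D S \<Delta>) v)"
    have col: "?col v = \<psi> n D S \<Delta> E v + 1" if "v \<in> V" for v by (rule A[OF nD g(4,1) that])
    have "proper_coloring V E ?col"
      using M(1) col unfolding proper_coloring_def colors_def by simp
    moreover have "1 \<le> ?col v \<and> real (?col v) \<le> (1 + \<mu>) * real S * real D ^ (xf S + 1)" if "v \<in> V" for v
    proof -
      have "\<psi> n D S \<Delta> E v + 1 \<le> M" using M(1) by (simp add: colors_def Suc_le_eq)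
      then have "real (\<psi> n D S \<Delta> E v + 1) \<le> real M" by (simp only: of_nat_le_iff)
      then show ?thesis using M(2) col[OF that] by simp
    qed
    ultimately show "let n = card V; D = diversity V E; S = max_clique_size V E; \<Delta> = max_degree V E;
           x = xf S;
           T = nat \<lceil>C * (real x * sqrt (real D * real S powr (1 / (real x + 1)))
                         * (ln (real \<Delta> + 2)) ^ 3 + real (log_star (real n)) + 1)\<rceil>;
           col = (\<lambda>v. A n D S \<Delta> (local_view V E T v))
       in proper_coloring V E col \<and>
          (\<forall>v\<in>V. 1 \<le> col v \<and> real (col v) \<le> (1 + \<mu>) * real S * real D ^ (x + 1))"
      unfolding Let_def T_def n_def D_def S_def \<Delta>_def by blast
  qed
qed

end
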